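(* Let $0<q<1$. For all non-negative integers $m$ and $n$ and every positive integer $r$, $$\sum_{k_1,\dots,k_r=-n}^n\ \prod_{1\le i<j\le r}[k_j-k_i]_q^2\,[k_i+k_j]_q^2\ \prod_{i=1}^r q^{k_i^2-2ik_i}\,\big|[k_i]_{q^2}\,[k_i]_q^2\big|\begin{bmatrix}2n\\ n+k_i\end{bmatrix}_q\begin{bmatrix}2m\\ m+k_i\end{bmatrix}_q$$ $$=r!\Big(\frac{2}{[2]_q}\Big)^r q^{-2\binom{r+1}{3}-\binom{r+1}{2}}\prod_{i=1}^r\Bigg(\frac{\Gamma_q(2n+1)}{\Gamma_q(n-i+1)^2}\cdot\frac{\Gamma_q(2m+1)}{\Gamma_q(m-i+1)^2}\cdot\frac{\Gamma_q(i)\,\Gamma_q(i+1)\,\Gamma_q(m+n-i-r+1)}{\Gamma_q(m+n-i+2)}\Bigg).$$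
   Context: Notation: $(a;q)_\infty=\prod_{k\ge1}(1-aq^{k-1})$; $(a;q)_k=\prod_{j=1}^k(1-aq^{j-1})$; $\begin{bmatrix}N\\ M\end{bmatrix}_q=\frac{(q;q)_N}{(q;q)_M(q;q)_{N-M}}$ for integers $0\le M\le N$, and $0$ for integers $M<0$ or $M>N$; $[x]_q=\frac{1-q^x}{1-q}$ (and $[x]_{q^2}$ is the same with $q$ replaced by $q^2$); $\Gamma_q(x)=(1-q)^{1-x}\frac{(q;q)_\infty}{(q^x;q)_\infty}$, so $1/\Gamma_q(x)=0$ for $x\in\{0,-1,-2,\dots\}$. If a numerator factor on the right-hand side has a pole, the right-hand side is understood as its limiting value when $m,n$ are replaced by $m+\varepsilon,n+\varepsilon$ and $\varepsilon\to0$. *)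

theory Defs
  imports "HOL-Complex_Analysis.Complex_Analysis"
begin

text \<open>The finite symbol \<open>(a; q)\<^sub>k\<close> and the infinite symbol \<open>(a; q)\<^sub>\<infinity>\<close>; products are
  indexed from \<open>0\<close>.\<close>

definition qpoch :: "real \<Rightarrow> real \<Rightarrow> nat \<Rightarrow> real" where
  "qpoch a q k = (\<Prod>j<k. 1 - a * q ^ j)"

definition qpoch_inf :: "real \<Rightarrow> real \<Rightarrow> real" where
  "qpoch_inf a q = (\<Prod>j. 1 - a * q ^ j)"

definition qbinomial :: "real \<Rightarrow> int \<Rightarrow> int \<Rightarrow> real" where
  "qbinomial q N M =
     (if 0 \<le> M \<and> M \<le> N
      then qpoch q q (nat N) / (qpoch q q (nat M) * qpoch q q (nat (N - M)))
      else 0)"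

definition qbracket :: "real \<Rightarrow> int \<Rightarrow> real" where
  "qbracket q x = (1 - q powi x) / (1 - q)"

text \<open>For \<open>0 < q < 1\<close> the poles on the real line are the zeros \<open>0, -1, -2, \<dots>\<close> of
  \<open>(q\<^sup>x; q)\<^sub>\<infinity>\<close>.  Since \<open>x / 0 = 0\<close>, the function takes the value \<open>0\<close> there; in a
  denominator this yields exactly the convention \<open>1 / \<Gamma>\<^sub>q(x) = 0\<close>, whereas in a numerator it is
  meaningless and must be replaced by a limit.\<close>

definition qGamma :: "real \<Rightarrow> real \<Rightarrow> real" where
  "qGamma q x = (1 - q) powr (1 - x) * qpoch_inf q q / qpoch_inf (q powr x) q"

end

theory Submission
  imports Defs "Jordan_Normal_Form.Determinant"
begin

text \<open>
  Put \<open>x\<^sub>k = q\<^sup>k + q\<^bsup>-k\<^esup>\<close>.  Since \<open>(1 - q\<^bsup>b-a\<^esup>)(1 - q\<^bsup>a+b\<^esup>) = q\<^sup>b (x\<^sub>b - x\<^sub>a)\<close>, the product over pairs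
  is, up to powers of \<open>q\<close> and \<open>1 - q\<close>, the square of a Vandermonde product in the \<open>x\<close>-variables.  The powers
  of \<open>q\<close> combine with the asymmetric factors \<open>q\<^bsup>-2ik\<^esup>\<close> to a weight that is the same for all
  variables and even.  So the multiple sum is a discrete Selberg-type integral with squared Vandermonde
  product, and Andreief's formula (\<open>andreief\<close>) expresses it as \<open>r!\<close> times a determinant of moments, with
  respect to any two sequences of polynomials of degrees \<open>0, 1, 2, \<dots>\<close>, divided by the product of
  their leading coefficients.

  A good choice are the polynomials that lower the upper index in the two \<open>q\<close>-binomial
  coefficients: in \<open>1 / ((q; q)\<^bsub>n-k\<^esub> (q; q)\<^bsub>n+k\<^esub>)\<close> the replacement of \<open>n\<close> by \<open>n - i\<close> is the
  multiplication by a polynomial of degree \<open>i\<close> in \<open>x\<^sub>k\<close>.  With these polynomials for \<open>n\<close> in the rows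
  and for \<open>m\<close> in the columns, every moment is, up to normalization, an instance of the single sum for
  \<open>r = 1\<close>, which reduces to two telescoping sums (\<open>base_moment\<close>).  After the removal of row and column factors the
  moments become \<open>1 / ((1 - q\<^bsup>N-i-j\<^esup>)(1 - q\<^bsup>N-i-j-1\<^esup>))\<close> with \<open>N = m + n\<close>, a Hankel array whose
  determinant Gaussian elimination evaluates (\<open>hankel_det\<close>).

  This settles the case \<open>r \<le> min m n\<close>, in which no \<open>q\<close>-gamma function in a numerator has a pole.
  If \<open>r > min m n\<close>, the multiple sum is zero by the pigeonhole principle (\<open>node_density_eq_0\<close>).  The
  right-hand side, with \<open>m\<close> and \<open>n\<close> moved by \<open>\<epsilon>\<close>, tends to zero, because it has more zeros
  than poles (\<open>gamma_product_tendsto_0\<close>), and its value without a limit is zero as well.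
\<close>

section \<open>Determinants of arrays and Andreief's formula\<close>

text \<open>An array of entries is easier to manipulate pointwise than a matrix; \<open>arr_det n f\<close> only looks
  at the arguments below \<open>n\<close>.\<close>

definition arr_det :: "nat \<Rightarrow> (nat \<Rightarrow> nat \<Rightarrow> 'a) \<Rightarrow> 'a :: comm_ring_1" where
  "arr_det n f = Determinant.det (Matrix.mat n n (\<lambda>(i, j). f i j))"

lemma permutes_less_bound:
  fixes p :: "nat \<Rightarrow> nat"
  assumes "p permutes {0..<n}" and "i < n"
  shows "p i < n"
  using permutes_in_image[OF assms(1), of i] assms(2) by simp

lemma arr_det_leibniz:
  "arr_det n f = (\<Sum>p | p permutes {0..<n}. of_int (sign p) * (\<Prod>i = 0..<n. f i (p i)))"
  unfolding arr_det_def
  by (subst det_def'[of _ n], simp)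
     (intro sum.cong refl arg_cong2[where f = "(*)"] prod.cong, auto dest: permutes_less_bound)

lemma arr_det_cong:
  assumes "\<And>i j. i < n \<Longrightarrow> j < n \<Longrightarrow> f i j = g i j"
  shows "arr_det n f = arr_det n g"
  unfolding arr_det_def by (rule arg_cong[where f = Determinant.det]) (auto intro!: eq_matI assms)

lemma arr_det_scale:
  "arr_det n (\<lambda>i j. a i * b j * f i j) = (\<Prod>i<n. a i) * (\<Prod>j<n. b j) * arr_det n f"
proof -
  have "of_int (sign p) * (\<Prod>i = 0..<n. a i * b (p i) * f i (p i)) =
      (\<Prod>i<n. a i) * (\<Prod>j<n. b j) * (of_int (sign p) * (\<Prod>i = 0..<n. f i (p i)))"
    if "p permutes {0..<n}" for p
  proof -
    have "(\<Prod>i = 0..<n. b (p i)) = (\<Prod>j = 0..<n. b j)"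
      using prod.permute[OF that, of b] by (simp add: o_def)
    then show ?thesis
      by (simp add: prod.distrib lessThan_atLeast0 algebra_simps)
  qed
  then show ?thesis
    unfolding arr_det_leibniz by (simp add: sum_distrib_left)
qed

lemma arr_det_transpose: "arr_det n (\<lambda>i j. f j i) = arr_det n f"
proof -
  have "Determinant.det (transpose_mat (Matrix.mat n n (\<lambda>(i, j). f i j))) = arr_det n f"
    unfolding arr_det_def by (rule det_transpose[of _ n]) simp
  moreover have "transpose_mat (Matrix.mat n n (\<lambda>(i, j). f i j)) = Matrix.mat n n (\<lambda>(i, j). f j i)"
    by (auto intro!: eq_matI)
  ultimately show ?thesis by (simp add: arr_det_def)
qed

lemma arr_det_permute_cols:
  assumes "p permutes {0..<n}"
  shows "arr_det n (\<lambda>i j. f i (p j)) = of_int (sign p) * arr_det n f"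
proof -
  have "arr_det n (\<lambda>i j. f i (p j)) = arr_det n (\<lambda>i j. f j (p i))"
    by (rule arr_det_transpose[symmetric])
  also have "\<dots> = of_int (sign p) * arr_det n (\<lambda>i j. f j i)"
  proof -
    let ?M = "Matrix.mat n n (\<lambda>(i, j). f j i)"
    have "Matrix.mat n n (\<lambda>(i, j). f j (p i)) = Matrix.mat n n (\<lambda>(i, j). ?M $$ (p i, j))"
      by (auto intro!: eq_matI simp: permutes_less_bound[OF assms])
    then show ?thesis
      using det_permute_rows[of ?M n p] assms by (simp add: arr_det_def)
  qed
  also have "arr_det n (\<lambda>i j. f j i) = arr_det n f"
    by (rule arr_det_transpose)
  finally show ?thesis .
qed

lemma arr_det_mult:
  "arr_det n (\<lambda>i j. \<Sum>l<n. f i l * g l j) = arr_det n f * arr_det n g"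
proof -
  have "Matrix.mat n n (\<lambda>(i, j). \<Sum>l<n. f i l * g l j) =
      Matrix.mat n n (\<lambda>(i, j). f i j) * Matrix.mat n n (\<lambda>(i, j). g i j)"
    by (auto intro!: eq_matI simp: scalar_prod_def lessThan_atLeast0)
  then show ?thesis
    unfolding arr_det_def by (simp add: det_mult[of _ n])
qed

lemma arr_det_lower_triangular:
  assumes "\<And>i j. i < j \<Longrightarrow> j < n \<Longrightarrow> f i j = 0"
  shows "arr_det n f = (\<Prod>i<n. f i i)"
proof -
  have "arr_det n f = prod_list (diag_mat (Matrix.mat n n (\<lambda>(i, j). f i j)))"
    unfolding arr_det_def by (rule det_lower_triangular[of n]) (use assms in auto)
  also have "\<dots> = (\<Prod>i<n. f i i)"
    by (simp add: prod_list_diag_prod lessThan_atLeast0)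
  finally show ?thesis .
qed

lemma arr_det_first_column:
  assumes "\<And>i. i < n \<Longrightarrow> f (Suc i) 0 = 0"
  shows "arr_det (Suc n) f = f 0 0 * arr_det n (\<lambda>i j. f (Suc i) (Suc j))"
proof -
  let ?M = "Matrix.mat (Suc n) (Suc n) (\<lambda>(i, j). f i j)"
  have "arr_det (Suc n) f = (\<Sum>i<Suc n. ?M $$ (i, 0) * cofactor ?M i 0)"
    unfolding arr_det_def by (rule laplace_expansion_column) auto
  also have "\<dots> = ?M $$ (0, 0) * cofactor ?M 0 0 + (\<Sum>i<n. ?M $$ (Suc i, 0) * cofactor ?M (Suc i) 0)"
    by (subst sum.lessThan_Suc_shift) simp
  also have "(\<Sum>i<n. ?M $$ (Suc i, 0) * cofactor ?M (Suc i) 0) = 0"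
    by (intro sum.neutral) (auto simp: assms)
  also have "cofactor ?M 0 0 = arr_det n (\<lambda>i j. f (Suc i) (Suc j))"
    unfolding cofactor_def arr_det_def
    by (auto intro!: arg_cong[where f = Determinant.det] eq_matI simp: mat_delete_def)
  finally show ?thesis by simp
qed

text \<open>All rows are changed at once: the combined operation is left multiplication by a lower
  bidiagonal matrix with unit diagonal, so row \<open>i\<close> receives a multiple of the original row
  \<open>i - 1\<close>, not of the changed one.\<close>

lemma arr_det_subtract_previous_row:
  "arr_det n (\<lambda>i j. f i j - (case i of 0 \<Rightarrow> 0 | Suc i' \<Rightarrow> c i' * f i' j)) = arr_det n f"
proof -
  define l where "l i k = (if k = i then 1 else if Suc k = i then - c k else (0 :: 'a))" for i k
  have "f i j - (case i of 0 \<Rightarrow> 0 | Suc i' \<Rightarrow> c i' * f i' j) = (\<Sum>k<n. l i k * f k j)"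
    if "i < n" for i j
  proof (cases i)
    case 0
    then have "(\<Sum>k<n. l i k * f k j) = (\<Sum>k\<in>{0}. l i k * f k j)"
      using that by (intro sum.mono_neutral_right) (auto simp: l_def)
    then show ?thesis using 0 by (simp add: l_def)
  next
    case (Suc i')
    then have "(\<Sum>k<n. l i k * f k j) = (\<Sum>k\<in>{i', i}. l i k * f k j)"
      using that by (intro sum.mono_neutral_right) (auto simp: l_def)
    then show ?thesis using Suc by (simp add: l_def)
  qed
  then have "arr_det n (\<lambda>i j. f i j - (case i of 0 \<Rightarrow> 0 | Suc i' \<Rightarrow> c i' * f i' j)) =
      arr_det n (\<lambda>i j. \<Sum>k<n. l i k * f k j)"
    by (intro arr_det_cong)
  also have "\<dots> = arr_det n l * arr_det n f"
    by (rule arr_det_mult)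
  also have "arr_det n l = 1"
    by (subst arr_det_lower_triangular) (auto simp: l_def)
  finally show ?thesis by simp
qed

text \<open>A generalized Vandermonde determinant: the array factors into the power array and the triangular
  array of coefficients.  Applying this factorization to the Newton basis at the nodes \<open>x\<close>
  themselves, for which the array is triangular too, evaluates the Vandermonde determinant.\<close>

lemma arr_det_poly:
  fixes p :: "nat \<Rightarrow> 'a :: idom poly"
  assumes deg: "\<And>j. j < n \<Longrightarrow> degree (p j) \<le> j"
  shows "arr_det n (\<lambda>i j. poly (p j) (x i)) =
    (\<Prod>j<n. coeff (p j) j) * (\<Prod>j<n. \<Prod>i<j. x j - x i)"
proof -
  have step: "arr_det n (\<lambda>i j. poly (p j) (x i)) =
      arr_det n (\<lambda>i j. x i ^ j) * (\<Prod>j<n. coeff (p j) j)"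
    if deg: "\<And>j. j < n \<Longrightarrow> degree (p j) \<le> j" for p :: "nat \<Rightarrow> 'a poly"
  proof -
    have "poly (p j) (x i) = (\<Sum>l<n. x i ^ l * coeff (p j) l)" if "j < n" for i j
    proof -
      have "poly (p j) (x i) = (\<Sum>l\<le>degree (p j). x i ^ l * coeff (p j) l)"
        by (simp add: poly_altdef mult.commute)
      also have "\<dots> = (\<Sum>l<n. x i ^ l * coeff (p j) l)"
        using deg[OF that] that
        by (intro sum.mono_neutral_left) (auto simp: coeff_eq_0)
      finally show ?thesis .
    qed
    then have "arr_det n (\<lambda>i j. poly (p j) (x i)) =
        arr_det n (\<lambda>i j. \<Sum>l<n. x i ^ l * coeff (p j) l)"
      by (intro arr_det_cong)
    also have "\<dots> = arr_det n (\<lambda>i j. x i ^ j) * arr_det n (\<lambda>l j. coeff (p j) l)"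
      by (rule arr_det_mult)
    also have "arr_det n (\<lambda>l j. coeff (p j) l) = arr_det n (\<lambda>j l. coeff (p j) l)"
      by (rule arr_det_transpose)
    also have "\<dots> = (\<Prod>j<n. coeff (p j) j)"
      using deg by (intro arr_det_lower_triangular coeff_eq_0) (meson le_less_trans less_trans)
    finally show ?thesis .
  qed
  \<comment> \<open>The Newton basis: \<open>N j\<close> vanishes at all nodes before \<open>x j\<close>.\<close>
  define N where "N j = (\<Prod>l<j. [:- x l, 1:])" for j
  have N: "degree (N j) = j \<and> coeff (N j) j = 1" for j
  proof (induction j)
    case (Suc j)
    have N_Suc: "N (Suc j) = [:- x j, 1:] * N j"
      by (simp add: N_def mult.commute)
    have "N j \<noteq> 0"
      using Suc by auto
    moreover have "degree [:- x j, 1:] = 1"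
      by simp
    ultimately have d: "degree (N (Suc j)) = Suc j"
      using Suc N_Suc by (metis degree_mult_eq plus_1_eq_Suc pCons_eq_0_iff one_neq_zero)
    have "coeff (N (Suc j)) (Suc j) = coeff (N j) j - x j * coeff (N j) (Suc j)"
      by (simp add: N_Suc)
    then show ?case
      using Suc d by (simp add: coeff_eq_0)
  qed (simp add: N_def)
  have "arr_det n (\<lambda>i j. poly (N j) (x i)) = (\<Prod>j<n. \<Prod>i<j. x j - x i)"
    by (subst arr_det_lower_triangular) (auto simp: N_def poly_prod prod_zero_iff)
  with step[of N] N have "arr_det n (\<lambda>i j. x i ^ j) = (\<Prod>j<n. \<Prod>i<j. x j - x i)"
    by simp
  with step[OF deg] show ?thesis by simp
qed

text \<open>Andreief's integration formula for a discrete measure.  Expanding the first determinant into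
  permutations, each permutation can be absorbed into a relabelling of the summation variables, which
  changes the second determinant by the same sign; so all permutations contribute equally.  In
  the remaining sum the variables separate.\<close>

lemma andreief:
  fixes w :: "'b \<Rightarrow> 'a :: comm_ring_1"
  assumes "finite K"
  shows "(\<Sum>k \<in> {0..<n} \<rightarrow>\<^sub>E K. (\<Prod>i = 0..<n. w (k i)) *
            arr_det n (\<lambda>i j. f j (k i)) * arr_det n (\<lambda>i j. g j (k i)))
         = of_nat (fact n) * arr_det n (\<lambda>i j. \<Sum>a\<in>K. w a * f i a * g j a)"
proof -
  let ?E = "{0..<n} \<rightarrow>\<^sub>E K" and ?G = "\<lambda>k. arr_det n (\<lambda>i j. g j (k i))"
  let ?W = "\<lambda>k. \<Prod>i = 0..<n. w (k i)"
  define T where "T k = ?W k * (\<Prod>i = 0..<n. f i (k i)) * ?G k" for k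
  have T_sum: "(\<Sum>k\<in>?E. T k) = arr_det n (\<lambda>i j. \<Sum>a\<in>K. w a * f i a * g j a)"
  proof -
    have "T k = (\<Sum>p | p permutes {0..<n}. of_int (sign p) *
        (\<Prod>i = 0..<n. w (k i) * f i (k i) * g (p i) (k i)))" for k
      unfolding T_def arr_det_leibniz by (simp add: sum_distrib_left prod.distrib algebra_simps)
    then have "(\<Sum>k\<in>?E. T k) = (\<Sum>k\<in>?E. \<Sum>p | p permutes {0..<n}. of_int (sign p) *
        (\<Prod>i = 0..<n. w (k i) * f i (k i) * g (p i) (k i)))" by simp
    also have "\<dots> = (\<Sum>p | p permutes {0..<n}. of_int (sign p) *
        (\<Sum>k\<in>?E. (\<Prod>i = 0..<n. w (k i) * f i (k i) * g (p i) (k i))))"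
      by (subst sum.swap) (simp add: sum_distrib_left)
    also have "\<dots> = arr_det n (\<lambda>i j. \<Sum>a\<in>K. w a * f i a * g j a)"
      unfolding arr_det_leibniz
      by (intro sum.cong refl arg_cong2[where f = "(*)"], rule prod_sum_PiE[symmetric]) (use assms in auto)
    finally show ?thesis .
  qed
  \<comment> \<open>The term of the permutation \<open>p\<close> is the sum of \<open>T\<close> after the substitution \<open>k \<circ> p\<^sup>-\<^sup>1\<close> for \<open>k\<close>.\<close>
  have perm: "(\<Sum>k\<in>?E. of_int (sign p) * (\<Prod>i = 0..<n. f (p i) (k i)) * ?W k * ?G k) = (\<Sum>k\<in>?E. T k)"
    if p: "p permutes {0..<n}" for p
  proof -
    have inv: "Hilbert_Choice.inv p permutes {0..<n}" using p by (rule permutes_inv)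
    have pE: "(\<lambda>i. k (s i)) \<in> ?E" if "k \<in> ?E" "s permutes {0..<n}" for k s
      using that permutes_in_image[OF that(2)] permutes_not_in[OF that(2)]
      by (fastforce simp: PiE_iff extensional_def)
    have T_perm: "T (\<lambda>i. k (Hilbert_Choice.inv p i)) = of_int (sign p) * (\<Prod>i = 0..<n. f (p i) (k i)) * ?W k * ?G k" for k
    proof -
      have "(\<Prod>i = 0..<n. w (k (Hilbert_Choice.inv p i))) = ?W k"
        using prod.permute[OF inv, of "\<lambda>i. w (k i)"] by (simp add: o_def)
      moreover have "(\<Prod>i = 0..<n. f i (k (Hilbert_Choice.inv p i))) = (\<Prod>i = 0..<n. f (p i) (k i))"
        using prod.permute[OF p, of "\<lambda>i. f i (k (Hilbert_Choice.inv p i))"] p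
        by (simp add: o_def permutes_inverses)
      moreover have "?G (\<lambda>i. k (Hilbert_Choice.inv p i)) = of_int (sign p) * ?G k"
      proof -
        have "?G (\<lambda>i. k (Hilbert_Choice.inv p i)) = arr_det n (\<lambda>i j. g i (k (Hilbert_Choice.inv p j)))"
          by (rule arr_det_transpose)
        also have "\<dots> = of_int (sign (Hilbert_Choice.inv p)) * arr_det n (\<lambda>i j. g i (k j))"
          by (rule arr_det_permute_cols[OF inv])
        also have "sign (Hilbert_Choice.inv p) = sign p"
          by (rule sign_inverse) (use p in \<open>auto simp: permutation_permutes\<close>)
        also have "arr_det n (\<lambda>i j. g i (k j)) = ?G k"
          by (rule arr_det_transpose)
        finally show ?thesis .
      qed
      ultimately show ?thesis by (simp add: T_def mult_ac)
    qed
    have "(\<Sum>k\<in>?E. T k) = (\<Sum>k\<in>?E. T (\<lambda>i. k (Hilbert_Choice.inv p i)))"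
      by (rule sum.reindex_bij_witness[of _ "\<lambda>k i. k (Hilbert_Choice.inv p i)" "\<lambda>k i. k (p i)"])
         (use p inv pE in \<open>simp_all add: permutes_inverses\<close>)
    then show ?thesis by (simp add: T_perm)
  qed
  have "?W k * arr_det n (\<lambda>i j. f j (k i)) * ?G k =
      (\<Sum>p | p permutes {0..<n}. of_int (sign p) * (\<Prod>i = 0..<n. f (p i) (k i)) * ?W k * ?G k)" for k
    by (subst arr_det_leibniz) (simp add: sum_distrib_left sum_distrib_right mult_ac)
  then have "(\<Sum>k\<in>?E. ?W k * arr_det n (\<lambda>i j. f j (k i)) * ?G k) =
      (\<Sum>p | p permutes {0..<n}. \<Sum>k\<in>?E.
         of_int (sign p) * (\<Prod>i = 0..<n. f (p i) (k i)) * ?W k * ?G k)"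
    by (subst sum.swap) simp
  also have "\<dots> = (\<Sum>p | p permutes {0..<n}. \<Sum>k\<in>?E. T k)"
    by (intro sum.cong refl perm) simp
  also have "\<dots> = of_nat (fact n) * arr_det n (\<lambda>i j. \<Sum>a\<in>K. w a * f i a * g j a)"
    by (simp add: T_sum card_permutations)
  finally show ?thesis .
qed

section \<open>Moments by telescoping\<close>

lemma qpoch_0 [simp]: "qpoch a q 0 = 1"
  by (simp add: qpoch_def)

lemma qpoch_Suc: "qpoch a q (Suc k) = qpoch a q k * (1 - a * q ^ k)"
  by (simp add: qpoch_def)

lemma qpoch_q_Suc: "qpoch q q (Suc k) = qpoch q q k * (1 - q ^ Suc k)"
  by (simp add: qpoch_Suc)

lemma one_minus_power_pos:
  fixes q :: real
  assumes "0 < q" "q < 1" "0 < k"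
  shows "0 < 1 - q ^ k"
  using assms by (simp add: power_less_one_iff)

lemma qpoch_q_pos:
  assumes "0 < q" "q < 1"
  shows "0 < qpoch q q k"
  using one_minus_power_pos[OF assms, of "Suc _"] unfolding qpoch_def
  by (intro prod_pos) auto

text \<open>This is \<open>1 / ((q; q)\<^bsub>n - k\<^esub> (q; q)\<^bsub>n + k\<^esub>)\<close>, that is, the central \<open>q\<close>-binomial coefficient
  without its factor \<open>(q; q)\<^bsub>2n\<^esub>\<close>.  The value \<open>0\<close> for \<open>k > n\<close> makes both recurrences below valid for
  all arguments.\<close>

definition recip_qfact_pair :: "real \<Rightarrow> nat \<Rightarrow> nat \<Rightarrow> real" where
  "recip_qfact_pair q n k =
     (if k \<le> n then 1 / (qpoch q q (n - k) * qpoch q q (n + k)) else 0)"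

lemma recip_qfact_pair_Suc_right:
  assumes "0 < q" "q < 1"
  shows "recip_qfact_pair q n (Suc k) * (1 - q ^ n * q ^ Suc k) =
         recip_qfact_pair q n k * (1 - q ^ n / q ^ k)"
proof -
  note pos = qpoch_q_pos[OF assms]
  consider "Suc k \<le> n" | "k = n" | "k > n" by linarith
  then show ?thesis
  proof cases
    case 1
    have 1: "n - k = Suc (n - Suc k)" "n + Suc k = Suc (n + k)"
      using 1 by auto
    have qn: "q ^ n / q ^ k = q ^ (n - k)"
      using assms 1 by (simp add: power_diff)
    have "1 - q ^ (n - k) > 0" "1 - q ^ n * q ^ Suc k > 0"
      using one_minus_power_pos[OF assms, of "n - k"] one_minus_power_pos[OF assms, of "n + Suc k"] \<open>Suc k \<le> n\<close>
      by (simp_all only: power_add)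
    moreover have "qpoch q q (n + Suc k) = qpoch q q (n + k) * (1 - q ^ n * q ^ Suc k)"
      using qpoch_q_Suc[of q "n + k"] by (simp add: power_add algebra_simps)
    moreover have "qpoch q q (n - k) = qpoch q q (n - Suc k) * (1 - q ^ (n - k))"
      using qpoch_q_Suc[of q "n - Suc k"] 1 by simp
    ultimately show ?thesis
      using \<open>Suc k \<le> n\<close> pos[of "n + k"] pos[of "n - Suc k"]
      unfolding recip_qfact_pair_def qn by (simp only:) (simp add: divide_simps)
  qed (use assms in \<open>auto simp: recip_qfact_pair_def\<close>)
qed

lemma recip_qfact_pair_Suc_left:
  assumes "0 < q" "q < 1"
  shows "recip_qfact_pair q n k =
         recip_qfact_pair q (Suc n) k * (1 - q ^ Suc n * q ^ k) * (1 - q ^ Suc n / q ^ k)"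
proof -
  note pos = qpoch_q_pos[OF assms]
  consider "k \<le> n" | "k = Suc n" | "k > Suc n" by linarith
  then show ?thesis
  proof cases
    case 1
    have 1: "Suc n - k = Suc (n - k)" "Suc n + k = Suc (n + k)"
      using 1 by auto
    have qn: "q ^ Suc n / q ^ k = q ^ (Suc n - k)"
      using assms 1 \<open>k \<le> n\<close> by (simp add: power_diff)
    have "1 - q ^ (Suc n - k) > 0" "1 - q ^ Suc n * q ^ k > 0"
      using one_minus_power_pos[OF assms, of "Suc n - k"] one_minus_power_pos[OF assms, of "Suc n + k"] \<open>k \<le> n\<close>
      by (simp_all only: power_add)
    moreover have "qpoch q q (Suc n + k) = qpoch q q (n + k) * (1 - q ^ Suc n * q ^ k)"
      using qpoch_q_Suc[of q "n + k"] by (simp add: power_add algebra_simps)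
    moreover have "qpoch q q (Suc n - k) = qpoch q q (n - k) * (1 - q ^ (Suc n - k))"
      using qpoch_q_Suc[of q "n - k"] 1 by simp
    ultimately show ?thesis
      using \<open>k \<le> n\<close> pos[of "n + k"] pos[of "n - k"]
      unfolding recip_qfact_pair_def qn by (simp only:) (simp add: divide_simps)
  qed (use assms in \<open>auto simp: recip_qfact_pair_def\<close>)
qed

text \<open>The summand is a difference \<open>T k - T (k + 1)\<close> because
  \<open>(1 - ab)(1 - ac) - (a - b)(a - c) = (1 - a\<^sup>2)(1 - bc)\<close>, used with \<open>a = q\<^sup>k\<close>, \<open>b = q\<^sup>n\<close>, \<open>c = q\<^sup>m\<close>.\<close>

lemma telescoped_sum:
  assumes q: "0 < q" "q < 1" and K: "n \<le> K"
  shows "(\<Sum>k = 1..K. q ^ (k * (k - 1)) * (1 - q ^ (2 * k)) *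
            recip_qfact_pair q n k * recip_qfact_pair q m k) * (1 - q ^ (n + m)) =
         (1 - q ^ Suc n) * (1 - q ^ Suc m) * recip_qfact_pair q n 1 * recip_qfact_pair q m 1"
proof -
  let ?A = "recip_qfact_pair q"
  define T where "T k = q ^ (k * (k - 1)) * (1 - q ^ n * q ^ k) * (1 - q ^ m * q ^ k) * ?A n k * ?A m k" for k
  have T_diff: "q ^ (k * (k - 1)) * (1 - q ^ (2 * k)) * ?A n k * ?A m k * (1 - q ^ (n + m)) = T k - T (Suc k)"
    if k1: "k \<ge> 1" for k
  proof -
    obtain l where k: "k = Suc l" using k1 by (cases k) auto
    have "T (Suc k) = q ^ (Suc k * k) * (?A n (Suc k) * (1 - q ^ n * q ^ Suc k)) * (?A m (Suc k) * (1 - q ^ m * q ^ Suc k))"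
      by (simp add: T_def)
    also have "\<dots> = q ^ (Suc k * k) * (?A n k * (1 - q ^ n / q ^ k)) * (?A m k * (1 - q ^ m / q ^ k))"
      by (simp only: recip_qfact_pair_Suc_right[OF q])
    also have "q ^ (Suc k * k) = q ^ (k * (k - 1)) * (q ^ k * q ^ k)"
    proof -
      have "Suc k * k = k * (k - 1) + (k + k)" by (simp add: k)
      then show ?thesis by (simp only: power_add)
    qed
    also have "q ^ (k * (k - 1)) * (q ^ k * q ^ k) * (?A n k * (1 - q ^ n / q ^ k)) * (?A m k * (1 - q ^ m / q ^ k)) =
        q ^ (k * (k - 1)) * ?A n k * ?A m k * (q ^ k * (1 - q ^ n / q ^ k)) * (q ^ k * (1 - q ^ m / q ^ k))"
      by (simp only: mult_ac)
    also have "q ^ k * (1 - q ^ n / q ^ k) = q ^ k - q ^ n"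
      using q by (simp add: field_simps)
    also have "q ^ k * (1 - q ^ m / q ^ k) = q ^ k - q ^ m"
      using q by (simp add: field_simps)
    finally have T': "T (Suc k) = q ^ (k * (k - 1)) * ?A n k * ?A m k * (q ^ k - q ^ n) * (q ^ k - q ^ m)" .
    show ?thesis
      unfolding T' unfolding T_def power_add mult_2 by (simp add: algebra_simps)
  qed
  have "(\<Sum>k = 1..K. q ^ (k * (k - 1)) * (1 - q ^ (2 * k)) * ?A n k * ?A m k) * (1 - q ^ (n + m)) =
      (\<Sum>k = 1..K. T k - T (Suc k))"
    unfolding sum_distrib_right by (intro sum.cong refl T_diff) simp
  also have "\<dots> = T 1 - T (Suc K)"
    by (induction K) auto
  also have "T (Suc K) = 0"
    using K by (simp add: T_def recip_qfact_pair_def)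
  finally show ?thesis by (simp add: T_def mult_ac)
qed

lemma recip_qfact_pair_1:
  assumes "0 < q" "q < 1"
  shows "(1 - q ^ Suc n) * recip_qfact_pair q n 1 = (1 - q ^ n) / (qpoch q q n)\<^sup>2"
proof (cases n)
  case (Suc n')
  have "1 - q ^ Suc n \<noteq> 0" "1 - q ^ Suc n' \<noteq> 0"
    using one_minus_power_pos[OF assms, of "Suc n"] one_minus_power_pos[OF assms, of "Suc n'"] by auto
  moreover have "qpoch q q n' \<noteq> 0"
    using qpoch_q_pos[OF assms, of n'] by simp
  moreover have "qpoch q q (Suc n) = qpoch q q n * (1 - q ^ Suc n)" "qpoch q q n = qpoch q q n' * (1 - q ^ Suc n')"
    unfolding Suc by (rule qpoch_q_Suc)+
  ultimately show ?thesis
    unfolding Suc recip_qfact_pair_def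
    by (simp del: power_Suc add: divide_simps power2_eq_square)
qed (simp add: recip_qfact_pair_def)

text \<open>The additional factor \<open>(1 - q\<^sup>k)\<^sup>2 / q\<^sup>k\<close> is affine in \<open>q\<^sup>k + q\<^bsup>-k\<^esup>\<close>, as is the factor that lowers
  the index of \<open>recip_qfact_pair\<close> by one.  Hence this sum is a combination of two telescoping
  sums, with first indices \<open>n + 1\<close> and \<open>n\<close>.\<close>

lemma base_moment:
  assumes q: "0 < q" "q < 1" and K: "Suc n \<le> K"
  shows "(\<Sum>k = 1..K. q ^ (k * (k - 1)) * (1 - q ^ (2 * k)) * ((1 - q ^ k)\<^sup>2 / q ^ k) *
            recip_qfact_pair q (Suc n) k * recip_qfact_pair q (Suc m) k) =
         (1 - q) / (q * (qpoch q q n)\<^sup>2 * (qpoch q q m)\<^sup>2 *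
           ((1 - q ^ (n + m + 2)) * (1 - q ^ (n + m + 1))))"
proof -
  let ?A = "recip_qfact_pair q"
  define B where "B n = (\<Sum>k = 1..K. q ^ (k * (k - 1)) * (1 - q ^ (2 * k)) * ?A n k * ?A (Suc m) k)" for n
  define Q where "Q = q ^ Suc n"
  define u v P R where "u = q ^ n" and "v = q ^ m" and "P = qpoch q q n" and "R = qpoch q q m"
  have nz: "q \<noteq> 0" "u \<noteq> 0" "P \<noteq> 0" "R \<noteq> 0" "1 - q * u \<noteq> 0" "1 - q * v \<noteq> 0"
      "1 - q * q * u * v \<noteq> 0" "1 - q * u * v \<noteq> 0"
    using q qpoch_q_pos[OF q, of n] qpoch_q_pos[OF q, of m] one_minus_power_pos[OF q, of "Suc n"] one_minus_power_pos[OF q, of "Suc m"]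
      one_minus_power_pos[OF q, of "Suc (n + m)"] one_minus_power_pos[OF q, of "Suc (Suc (n + m))"]
    by (auto simp: u_def v_def P_def R_def power_add less_imp_neq algebra_simps
             dest: less_imp_neq)
  have "(1 - x)\<^sup>2 / x * a = (1 - Q)\<^sup>2 / Q * a - a * (1 - Q * x) * (1 - Q / x) / Q" if "x \<noteq> 0" for a x
  proof -
    have "Q \<noteq> 0" using q by (simp add: Q_def)
    then show ?thesis using that
      by (simp add: divide_simps) (simp add: power2_eq_square algebra_simps)
  qed
  from this[of "q ^ _" "?A (Suc n) _"]
  have rec: "(1 - q ^ k)\<^sup>2 / q ^ k * ?A (Suc n) k = (1 - Q)\<^sup>2 / Q * ?A (Suc n) k - ?A n k / Q" for k
    using q by (simp add: recip_qfact_pair_Suc_left[OF q, of n] Q_def)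
  have "(\<Sum>k = 1..K. q ^ (k * (k - 1)) * (1 - q ^ (2 * k)) * ((1 - q ^ k)\<^sup>2 / q ^ k) *
            ?A (Suc n) k * ?A (Suc m) k) =
      (\<Sum>k = 1..K. q ^ (k * (k - 1)) * (1 - q ^ (2 * k)) * ((1 - q ^ k)\<^sup>2 / q ^ k *
            ?A (Suc n) k) * ?A (Suc m) k)"
    by (simp only: mult.assoc)
  also have "\<dots> = (1 - Q)\<^sup>2 / Q * B (Suc n) - B n / Q"
  proof -
    have "c * (y * a - b / Q) * d = y * (c * a * d) - (c * b * d) / Q" for a b c d y
      by (simp add: algebra_simps)
    then show ?thesis
      unfolding rec B_def by (simp only: sum_subtractf sum_distrib_left sum_divide_distrib)
  qed
  also have "B (Suc n) = 1 / (P\<^sup>2 * (1 - q * u) * R\<^sup>2 * (1 - q * v) * (1 - q * q * u * v))"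
  proof -
    have "B (Suc n) * (1 - q ^ (Suc n + Suc m)) =
        ((1 - q ^ Suc (Suc n)) * ?A (Suc n) 1) * ((1 - q ^ Suc (Suc m)) * ?A (Suc m) 1)"
      using telescoped_sum[OF q K, of "Suc m"] by (simp only: B_def mult_ac)
    also have "\<dots> = 1 / (P\<^sup>2 * (1 - q * u) * R\<^sup>2 * (1 - q * v))"
      unfolding recip_qfact_pair_1[OF q] qpoch_q_Suc using nz
      by (simp add: P_def R_def u_def v_def divide_simps power2_eq_square)
    finally show ?thesis
      using nz by (simp add: u_def v_def power_add divide_simps mult_ac)
  qed
  also have "B n = (1 - u) / (P\<^sup>2 * R\<^sup>2 * (1 - q * v) * (1 - q * u * v))"
  proof -
    have "B n * (1 - q ^ (n + Suc m)) =
        ((1 - q ^ Suc n) * ?A n 1) * ((1 - q ^ Suc (Suc m)) * ?A (Suc m) 1)"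
      using telescoped_sum[OF q, of n K "Suc m"] K by (simp only: B_def mult_ac)
    also have "\<dots> = (1 - u) / (P\<^sup>2 * R\<^sup>2 * (1 - q * v))"
      unfolding recip_qfact_pair_1[OF q] qpoch_q_Suc using nz
      by (simp add: P_def R_def u_def v_def divide_simps power2_eq_square)
    finally show ?thesis
      using nz by (simp add: u_def v_def power_add divide_simps mult_ac)
  qed
  also have "(1 - Q)\<^sup>2 / Q * (1 / (P\<^sup>2 * (1 - q * u) * R\<^sup>2 * (1 - q * v) * (1 - q * q * u * v))) -
      (1 - u) / (P\<^sup>2 * R\<^sup>2 * (1 - q * v) * (1 - q * u * v)) / Q =
      (1 - q) / (q * P\<^sup>2 * R\<^sup>2 * ((1 - q * q * u * v) * (1 - q * u * v)))"
  proof -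
    have Q: "Q = q * u" by (simp add: Q_def u_def)
    show ?thesis unfolding Q using nz by (simp add: divide_simps) (simp add: power2_eq_square algebra_simps)
  qed
  also have "\<dots> = (1 - q) / (q * (qpoch q q n)\<^sup>2 * (qpoch q q m)\<^sup>2 *
           ((1 - q ^ (n + m + 2)) * (1 - q ^ (n + m + 1))))"
    by (simp add: P_def R_def u_def v_def power_add mult_ac power2_eq_square)
  finally show ?thesis .
qed

text \<open>In the variable \<open>x = q\<^sup>k + q\<^bsup>-k\<^esup>\<close> each linear factor equals
  \<open>(1 - q\<^bsup>n-l+k\<^esup>)(1 - q\<^bsup>n-l-k\<^esup>)\<close>; so multiplication by the polynomial lowers the index \<open>n\<close> by \<open>i\<close>.\<close>

definition shift_poly :: "real \<Rightarrow> nat \<Rightarrow> nat \<Rightarrow> real poly" where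
  "shift_poly q n i = (\<Prod>l<i. [:(1 + q ^ (2 * (n - l))), - (q ^ (n - l)):])"

lemma shift_poly_recip_qfact_pair:
  assumes q: "0 < q" "q < 1" and "i \<le> n"
  shows "poly (shift_poly q n i) (q ^ k + 1 / q ^ k) * recip_qfact_pair q n k = recip_qfact_pair q (n - i) k"
  using assms(3)
proof (induction i)
  case (Suc i)
  define j where "j = n - Suc i"
  have n: "n - i = Suc j" using Suc by (simp add: j_def)
  have "poly (shift_poly q n (Suc i)) (q ^ k + 1 / q ^ k) * recip_qfact_pair q n k =
      poly [:(1 + q ^ (2 * Suc j)), - (q ^ Suc j):] (q ^ k + 1 / q ^ k) * recip_qfact_pair q (Suc j) k"
  proof -
    have "shift_poly q n (Suc i) = shift_poly q n i * [:(1 + q ^ (2 * Suc j)), - (q ^ Suc j):]"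
      by (simp only: shift_poly_def prod.lessThan_Suc n)
    moreover have IH: "recip_qfact_pair q (Suc j) k =
        poly (shift_poly q n i) (q ^ k + 1 / q ^ k) * recip_qfact_pair q n k"
      using Suc by (simp only: n[symmetric])
    ultimately show ?thesis
      unfolding IH by (simp only: poly_mult mult_ac)
  qed
  also have "poly [:(1 + q ^ (2 * Suc j)), - (q ^ Suc j):] (q ^ k + 1 / q ^ k) =
      (1 - q ^ Suc j * q ^ k) * (1 - q ^ Suc j / q ^ k)"
  proof -
    have "1 + Q\<^sup>2 + (x + 1 / x) * - Q = (1 - Q * x) * (1 - Q / x)" if "x \<noteq> 0" for x Q :: real
      using that by (simp add: divide_simps) (simp add: power2_eq_square algebra_simps)
    from this[of "q ^ k" "q ^ Suc j"] show ?thesis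
      unfolding power_even_eq using q by (simp del: power_Suc)
  qed
  finally show ?case
    using recip_qfact_pair_Suc_left[OF q, of j k] by (simp add: j_def mult_ac)
qed (simp add: shift_poly_def)

lemma degree_coeff_shift_poly:
  assumes "0 < q"
  shows "degree (shift_poly q n i) = i" "coeff (shift_poly q n i) i = (\<Prod>l<i. - (q ^ (n - l)))"
proof -
  let ?f = "\<lambda>l. [:(1 + q ^ (2 * (n - l))), - (q ^ (n - l)):]"
  have "degree (shift_poly q n i) = (\<Sum>l<i. degree (?f l))"
    unfolding shift_poly_def using assms by (intro degree_prod_eq_sum_degree) auto
  also have "\<dots> = i" using assms by simp
  finally show *: "degree (shift_poly q n i) = i" .
  have "lead_coeff (shift_poly q n i) = (\<Prod>l<i. lead_coeff (?f l))"
    unfolding shift_poly_def by (rule lead_coeff_prod)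
  then show "coeff (shift_poly q n i) i = (\<Prod>l<i. - (q ^ (n - l)))"
    using * assms by simp
qed

section \<open>A Hankel determinant of quotients of finite products\<close>

text \<open>One step of Gaussian elimination.  Subtracting from each row the multiple of the previous one that
  clears the first column turns the entries into entries of the same shape, with \<open>s\<close> raised and \<open>N\<close>
  lowered by one, times factors that depend on the row or on the column only.\<close>

lemma hankel_det_step:
  assumes q: "0 < q" "q < 1" and N: "2 * n + s + 1 \<le> N"
  shows "arr_det (Suc n) (\<lambda>i j. qpoch q q (N - i - j - s - 1) / qpoch q q (N - i - j)) =
    qpoch q q (N - s - 1) / qpoch q q N *
    (\<Prod>i<n. q ^ (N - i - s - 1) * (1 - q ^ Suc s) / (1 - q ^ (N - i - s - 1))) *
    (\<Prod>j<n. (1 - q ^ Suc j) / q ^ Suc j) *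
    arr_det n (\<lambda>i j. qpoch q q (N - 1 - i - j - Suc s - 1) / qpoch q q (N - 1 - i - j))"
proof -
  define f where "f i j = qpoch q q (N - i - j - s - 1) / qpoch q q (N - i - j)" for i j
  define c where "c i = (1 - q ^ (N - i)) / (1 - q ^ (N - i - s - 1))" for i
  define g where "g i j = f i j - (case i of 0 \<Rightarrow> 0 | Suc i' \<Rightarrow> c i' * f i' j)" for i j
  have g_Suc: "g (Suc i) j = q ^ (N - i - s - 1) * (1 - q ^ Suc s) / (1 - q ^ (N - i - s - 1)) *
      ((1 - q ^ j) / q ^ j) * (qpoch q q (N - i - j - s - 2) / qpoch q q (N - i - j))"
    if ij: "i < n" "j \<le> n" for i j
  proof -
    \<comment> \<open>The smallest index of a finite product among the three entries involved; with it all natural differences become sums.\<close>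
    define d where "d = N - i - j - s - 2"
    have *: "N - i - j = Suc (d + Suc s)" "N - Suc i - j = d + Suc s" "N - i = Suc (d + s + j + 1)"
        "N - i - j - s - 1 = Suc d" "N - Suc i - j - s - 1 = d" "N - i - s - 1 = Suc (d + j)"
        "N - i - j - s - 2 = d"
      using ij N by (auto simp: d_def)
    have nz: "1 - q ^ Suc (d + Suc s) \<noteq> 0" "1 - q ^ Suc (d + j) \<noteq> 0" "qpoch q q (d + Suc s) \<noteq> 0"
        "q \<noteq> 0"
      using q one_minus_power_pos[OF q, of "Suc (d + Suc s)"] one_minus_power_pos[OF q, of "Suc (d + j)"]
        qpoch_q_pos[OF q, of "d + Suc s"] by auto
    define D S J where "D = q ^ Suc d" and "S = q ^ Suc s" and "J = q ^ j"
    define a b where "a = qpoch q q d" and "b = qpoch q q (d + Suc s)"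
    have pw: "q ^ Suc (d + Suc s) = D * S" "q ^ Suc (d + j) = D * J" "q ^ Suc (d + s + j + 1) = D * S * J"
      by (simp_all add: D_def S_def J_def power_add mult_ac)
    have nz': "1 - D * S \<noteq> 0" "1 - D * J \<noteq> 0" "b \<noteq> 0" "J \<noteq> 0"
      using nz unfolding pw by (auto simp: b_def J_def)
    have "g (Suc i) j = a / b - (1 - D * S * J) / (1 - D * J) * (a * (1 - D) / (b * (1 - D * S)))"
    proof -
      have "f (Suc i) j = a / b"
        unfolding f_def unfolding *(5) unfolding *(2) a_def b_def ..
      moreover have "f i j = a * (1 - D) / (b * (1 - D * S))"
        unfolding f_def unfolding *(4) unfolding *(1) qpoch_q_Suc pw a_def b_def D_def ..
      moreover have "c i = (1 - D * S * J) / (1 - D * J)"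
        unfolding c_def unfolding *(6) unfolding *(3) pw ..
      ultimately show ?thesis by (simp add: g_def)
    qed
    also have "\<dots> = D * J * (1 - S) / (1 - D * J) * ((1 - J) / J) * (a / (b * (1 - D * S)))"
      using nz' by (simp add: divide_simps) (simp add: power2_eq_square algebra_simps)
    finally show ?thesis
      unfolding *(6) *(7) unfolding *(1) unfolding qpoch_q_Suc pw S_def[symmetric] J_def[symmetric] a_def[symmetric] b_def[symmetric] .
  qed
  have "arr_det (Suc n) f = arr_det (Suc n) g"
    unfolding g_def by (rule arr_det_subtract_previous_row[symmetric])
  also have "\<dots> = g 0 0 * arr_det n (\<lambda>i j. g (Suc i) (Suc j))"
    by (rule arr_det_first_column) (simp add: g_Suc)
  also have "arr_det n (\<lambda>i j. g (Suc i) (Suc j)) =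
      arr_det n (\<lambda>i j. (q ^ (N - i - s - 1) * (1 - q ^ Suc s) / (1 - q ^ (N - i - s - 1))) *
        ((1 - q ^ Suc j) / q ^ Suc j) *
        (qpoch q q (N - 1 - i - j - Suc s - 1) / qpoch q q (N - 1 - i - j)))"
  proof (rule arr_det_cong)
    fix i j assume ij: "i < n" "j < n"
    have "N - i - Suc j - s - 2 = N - 1 - i - j - Suc s - 1" "N - i - Suc j = N - 1 - i - j"
      by auto
    then show "g (Suc i) (Suc j) = (q ^ (N - i - s - 1) * (1 - q ^ Suc s) / (1 - q ^ (N - i - s - 1))) *
        ((1 - q ^ Suc j) / q ^ Suc j) *
        (qpoch q q (N - 1 - i - j - Suc s - 1) / qpoch q q (N - 1 - i - j))"
      using g_Suc[of i "Suc j"] ij by (simp only: Suc_le_eq)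
  qed
  also have "\<dots> = (\<Prod>i<n. q ^ (N - i - s - 1) * (1 - q ^ Suc s) / (1 - q ^ (N - i - s - 1))) *
    (\<Prod>j<n. (1 - q ^ Suc j) / q ^ Suc j) *
    arr_det n (\<lambda>i j. qpoch q q (N - 1 - i - j - Suc s - 1) / qpoch q q (N - 1 - i - j))"
    by (rule arr_det_scale)
  also have "g 0 0 = qpoch q q (N - s - 1) / qpoch q q N"
    by (simp add: g_def f_def)
  finally show ?thesis unfolding f_def by (simp only: mult_ac)
qed

lemma qpoch_q_split_top:
  "n \<le> M \<Longrightarrow> qpoch q q M = qpoch q q (M - n) * (\<Prod>i<n. 1 - q ^ (M - i))"
proof (induction n)
  case (Suc n)
  then have "M - n = Suc (M - Suc n)" by simp
  then have "qpoch q q (M - n) = qpoch q q (M - Suc n) * (1 - q ^ (M - n))"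
    by (metis qpoch_q_Suc)
  with Suc show ?case by (simp add: mult_ac)
qed simp

lemma prod_power_quotient:
  fixes q :: real
  assumes "q \<noteq> 0"
  shows "n \<le> M \<Longrightarrow> (\<Prod>i<n. q ^ (M - i) / q ^ Suc i) = q ^ (n * (M - n))"
proof (induction n)
  case (Suc n)
  have *: "n * (M - n) + (M - n) = Suc n * (M - Suc n) + Suc n"
  proof -
    obtain d where "M = Suc n + d" using Suc.prems le_Suc_ex by blast
    then show ?thesis by (simp add: algebra_simps)
  qed
  have "(\<Prod>i<Suc n. q ^ (M - i) / q ^ Suc i) = (\<Prod>i<n. q ^ (M - i) / q ^ Suc i) * (q ^ (M - n) / q ^ Suc n)"
    by (rule prod.lessThan_Suc)
  also have "(\<Prod>i<n. q ^ (M - i) / q ^ Suc i) = q ^ (n * (M - n))"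
    by (rule Suc.IH) (use Suc.prems in simp)
  also have "q ^ (n * (M - n)) * (q ^ (M - n) / q ^ Suc n) = q ^ (n * (M - n) + (M - n)) / q ^ Suc n"
    by (simp only: power_add times_divide_eq_right)
  also have "\<dots> = q ^ (Suc n * (M - Suc n))"
    unfolding * power_add[of q _ "Suc n"] using assms by (intro nonzero_mult_div_cancel_right) simp
  finally show ?case .
qed simp

text \<open>The case \<open>s = 1\<close> is the one needed for the moments; the elimination step changes \<open>s\<close>, so the
  induction needs the whole family.\<close>

lemma hankel_det:
  assumes q: "0 < q" "q < 1"
  shows "2 * n + s \<le> Suc N \<Longrightarrow>
    arr_det n (\<lambda>i j. qpoch q q (N - i - j - s - 1) / qpoch q q (N - i - j)) =
    q ^ (\<Sum>i<n. i * (Suc N - s - 2 * n + i)) *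
    (\<Prod>i<n. qpoch q q i * qpoch q q (s + i) / qpoch q q s *
       (qpoch q q (N - i - n - s) / qpoch q q (N - i)))"
proof (induction n arbitrary: N s)
  case 0
  then show ?case by (simp add: arr_det_leibniz)
next
  case (Suc n)
  let ?p = "qpoch q q"
  have nz: "?p k \<noteq> 0" for k
    using qpoch_q_pos[OF q, of k] by simp
  define M where "M = N - s - 1"
  have M: "2 * n \<le> M" and N: "N = M + s + 1"
    using Suc.prems by (auto simp: M_def)
  define h where "h i = ?p i * ?p (Suc s + i) / ?p (Suc s) / ?p (N - 1 - i)" for i
  have IH: "arr_det n (\<lambda>i j. ?p (N - 1 - i - j - Suc s - 1) / ?p (N - 1 - i - j)) =
      q ^ (\<Sum>i<n. i * (M - 2 * n + i)) * (\<Prod>i<n. h i * ?p (M - Suc n - i))"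
  proof -
    have "Suc (N - 1) - Suc s - 2 * n + i = M - 2 * n + i" for i
      by (simp add: N)
    moreover have "N - 1 - i - n - Suc s = M - Suc n - i" for i
      by (simp add: N)
    moreover have "2 * n + Suc s \<le> Suc (N - 1)"
      using M by (simp add: N)
    ultimately show ?thesis
      using Suc.IH[of "Suc s" "N - 1"] by (simp only: h_def times_divide_eq_right times_divide_eq_left)
  qed
  have pow: "(\<Prod>i<n. q ^ (M - i) * (1 - q ^ Suc s) / (1 - q ^ (M - i))) * (\<Prod>j<n. (1 - q ^ Suc j) / q ^ Suc j) =
      q ^ (n * (M - n)) * (\<Prod>i<n. (1 - q ^ Suc i) * (1 - q ^ Suc s)) / (\<Prod>i<n. 1 - q ^ (M - i))"
  proof -
    have nzq: "(\<Prod>i<n. q ^ Suc i) \<noteq> 0" using q by simp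
    have "(\<Prod>i<n. q ^ (M - i)) = q ^ (n * (M - n)) * (\<Prod>i<n. q ^ Suc i)"
    proof -
      have "(\<Prod>i<n. q ^ (M - i)) / (\<Prod>i<n. q ^ Suc i) = q ^ (n * (M - n))"
        unfolding prod_dividef[symmetric] by (rule prod_power_quotient) (use q M in auto)
      then show ?thesis unfolding nonzero_divide_eq_eq[OF nzq] .
    qed
    with nzq show ?thesis
      by (simp add: prod.distrib prod_dividef mult_ac del: power_Suc)
  qed
  have pM: "?p M / (\<Prod>i<n. 1 - q ^ (M - i)) = ?p (M - n)"
    using qpoch_q_split_top[of n M q] nz[of M] M by simp
  have exps: "(\<Sum>i<Suc n. i * (Suc N - s - 2 * Suc n + i)) = n * (M - n) + (\<Sum>i<n. i * (M - 2 * n + i))"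
    using M by (simp add: N)
  have shift: "(\<Prod>i<Suc n. ?p i * ?p (s + i) / ?p s * (?p (N - i - Suc n - s) / ?p (N - i))) =
      ?p (M - n) / ?p N * (\<Prod>i<n. (1 - q ^ Suc i) * (1 - q ^ Suc s)) * (\<Prod>i<n. h i * ?p (M - Suc n - i))"
  proof -
    have "?p (Suc i) * ?p (s + Suc i) / ?p s * (?p (N - Suc i - Suc n - s) / ?p (N - Suc i)) =
        (1 - q ^ Suc i) * (1 - q ^ Suc s) * (h i * ?p (M - Suc n - i))" for i
    proof -
      have e1: "?p (N - Suc i - Suc n - s) = ?p (M - Suc n - i)"
        by (simp add: N add.commute)
      have e2: "?p (N - Suc i) = ?p (N - 1 - i)" and e3: "?p (s + Suc i) = ?p (Suc s + i)"
        by simp_all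
      have e4: "?p (Suc s) = ?p s * (1 - q ^ Suc s)"
        by (rule qpoch_q_Suc)
      have nz': "?p s \<noteq> 0" "1 - q ^ Suc s \<noteq> 0"
        using nz[of "Suc s"] unfolding e4 by auto
      have "a * S * x / b * (y / z) = S * T * (a * x / (b * T) / z * y)"
        if "b \<noteq> 0" "T \<noteq> 0" for a b x y z S T :: real
        using that by simp
      from this[OF nz'] show ?thesis
        unfolding h_def e1 e2 e3 e4 qpoch_q_Suc[of q i] .
    qed
    moreover have "N - 0 - Suc n - s = M - n" using N by simp
    ultimately show ?thesis
      using nz[of s] unfolding prod.lessThan_Suc_shift by (simp only: prod.distrib) simp
  qed
  have "arr_det (Suc n) (\<lambda>i j. ?p (N - i - j - s - 1) / ?p (N - i - j)) =
      ?p M / ?p N * ((\<Prod>i<n. q ^ (M - i) * (1 - q ^ Suc s) / (1 - q ^ (M - i))) * (\<Prod>j<n. (1 - q ^ Suc j) / q ^ Suc j)) *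
      (q ^ (\<Sum>i<n. i * (M - 2 * n + i)) * (\<Prod>i<n. h i * ?p (M - Suc n - i)))"
  proof -
    have "N - i - s - 1 = M - i" for i by (simp add: M_def)
    moreover have "2 * n + s + 1 \<le> N" using Suc.prems by simp
    ultimately show ?thesis
      using hankel_det_step[OF q, of n s N] unfolding IH by (simp only: M_def[symmetric] mult_ac)
  qed
  also have "\<dots> = q ^ (n * (M - n) + (\<Sum>i<n. i * (M - 2 * n + i))) *
      (?p M / (\<Prod>i<n. 1 - q ^ (M - i)) / ?p N * (\<Prod>i<n. (1 - q ^ Suc i) * (1 - q ^ Suc s)) * (\<Prod>i<n. h i * ?p (M - Suc n - i)))"
    unfolding pow power_add by (simp del: power_Suc add: mult_ac)
  finally show ?case
    unfolding exps shift pM .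
qed

section \<open>The multiple sum as a determinant of moments\<close>

text \<open>The variable in which the product over pairs is a squared Vandermonde product, up to powers of
  \<open>q\<close> and \<open>1 - q\<close>.\<close>

definition node :: "real \<Rightarrow> int \<Rightarrow> real" where
  "node q a = q powi a + q powi (- a)"

text \<open>The reason is \<open>(1 - q\<^bsup>b-a\<^esup>)(1 - q\<^bsup>a+b\<^esup>) = q\<^sup>b (node q b - node q a)\<close>.  The prefactor \<open>q\<^bsup>2b\<^esup>\<close>
  cancels the asymmetric powers of \<open>q\<close> in the multiple sum.\<close>

lemma qbracket_pair:
  assumes "q \<noteq> 0"
  shows "(qbracket q (b - a))\<^sup>2 * (qbracket q (a + b))\<^sup>2 =
         (q powi b)\<^sup>2 * (node q b - node q a)\<^sup>2 / (1 - q) ^ 4"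
proof -
  define X Y where "X = q powi a" and "Y = q powi b"
  have nz: "X \<noteq> 0" "Y \<noteq> 0" using assms by (auto simp: X_def Y_def)
  have "(1 - q powi (b - a)) * (1 - q powi (a + b)) = Y * (node q b - node q a)"
    using assms nz unfolding node_def
    by (simp add: power_int_add power_int_diff power_int_minus X_def[symmetric] Y_def[symmetric] field_simps)
  then have "((1 - q powi (b - a)) * (1 - q powi (a + b)))\<^sup>2 = Y\<^sup>2 * (node q b - node q a)\<^sup>2"
    by (simp add: power_mult_distrib)
  moreover have "(qbracket q (b - a))\<^sup>2 * (qbracket q (a + b))\<^sup>2 =
      ((1 - q powi (b - a)) * (1 - q powi (a + b)))\<^sup>2 / (1 - q) ^ 4"
    by (simp add: qbracket_def power_divide power_mult_distrib flip: power_add)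
  ultimately show ?thesis by (simp add: Y_def)
qed

text \<open>This is the one-variable factor of the multiple sum at \<open>i = 1\<close>; the powers \<open>q\<^bsup>-2(i - 1)a\<^esup>\<close> that
  distinguish the variables are cancelled by those coming from \<open>qbracket_pair\<close>.\<close>

definition weight :: "real \<Rightarrow> nat \<Rightarrow> nat \<Rightarrow> int \<Rightarrow> real" where
  "weight q n m a = q powi (a\<^sup>2 - 2 * a) * \<bar>qbracket (q\<^sup>2) a * (qbracket q a)\<^sup>2\<bar>
     * qbinomial q (2 * int n) (int n + a) * qbinomial q (2 * int m) (int m + a)"

lemma qbinomial_central:
  "qbinomial q (2 * int n) (int n + a) = qpoch q q (2 * n) * recip_qfact_pair q n (nat \<bar>a\<bar>)"
proof (cases "a \<ge> 0")
  case True
  then obtain k where a: "a = int k" using nonneg_int_cases by blast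
  have "nat (2 * int n - (int n + int k)) = n - k" "nat (int n + int k) = n + k" "nat (2 * int n) = 2 * n"
    by auto
  then show ?thesis unfolding a qbinomial_def recip_qfact_pair_def by (auto simp: mult_ac)
next
  case False
  then obtain k where a: "a = - int k" by (metis int_cases4 linorder_le_cases of_nat_0_le_iff nle_le)
  have "nat (2 * int n - (int n + - int k)) = n + k" "nat (int n + - int k) = n - k" "nat (2 * int n) = 2 * n"
    by auto
  then show ?thesis unfolding a qbinomial_def recip_qfact_pair_def by (auto simp: mult_ac)
qed

lemma qbracket_minus:
  assumes "q \<noteq> 0"
  shows "qbracket q (- a) = - (q powi (- a) * qbracket q a)"
proof -
  have "1 - q powi (- a) = - (q powi (- a) * (1 - q powi a))"
    using assms by (simp add: power_int_minus field_simps)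
  then show ?thesis by (simp add: qbracket_def)
qed

lemma weight_minus:
  assumes "0 < q"
  shows "weight q n m (- a) = weight q n m a"
proof -
  have "(q\<^sup>2) powi (- a) = (q powi (- a))\<^sup>2"
    by (simp add: power2_eq_square power_int_mult_distrib)
  then have "\<bar>qbracket (q\<^sup>2) (- a) * (qbracket q (- a))\<^sup>2\<bar> =
      (q powi (- a)) ^ 4 * \<bar>qbracket (q\<^sup>2) a * (qbracket q a)\<^sup>2\<bar>"
    using assms by (simp add: qbracket_minus abs_mult power_mult_distrib mult_ac flip: power_add)
  moreover have "q powi ((- a)\<^sup>2 - 2 * (- a)) * (q powi (- a)) ^ 4 = q powi (a\<^sup>2 - 2 * a)"
  proof -
    have "(q powi (- a)) ^ 4 = q powi (- 4 * a)"
      using power_int_mult[of q "- a" 4] by (simp add: mult.commute)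
    then show ?thesis
      using assms by (simp flip: power_int_add)
  qed
  ultimately show ?thesis
    unfolding weight_def qbinomial_central by (simp add: mult_ac)
qed

lemma weight_0: "weight q n m 0 = 0"
  by (simp add: weight_def qbracket_def)

lemma weight_nat:
  assumes q: "0 < q" "q < 1" and k: "k \<ge> 1"
  shows "weight q n m (int k) = qpoch q q (2 * n) * qpoch q q (2 * m) / ((1 - q\<^sup>2) * (1 - q)\<^sup>2) *
    (q ^ (k * (k - 1)) * (1 - q ^ (2 * k)) * ((1 - q ^ k)\<^sup>2 / q ^ k) *
     recip_qfact_pair q n k * recip_qfact_pair q m k)"
proof -
  have "q powi ((int k)\<^sup>2 - 2 * int k) = q powi (int (k * (k - 1)) - int k)"
    using k by (intro arg_cong[where f = "\<lambda>z. q powi z"])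
      (simp add: power2_eq_square of_nat_diff algebra_simps)
  also have "\<dots> = q ^ (k * (k - 1)) / q ^ k"
    using q by (subst power_int_diff) (auto simp: power_int_of_nat simp del: of_nat_mult)
  finally have 1: "q powi ((int k)\<^sup>2 - 2 * int k) = q ^ (k * (k - 1)) / q ^ k" .
  have "q\<^sup>2 < 1" using q by (simp add: power_less_one_iff)
  moreover have "q ^ (2 * k) \<le> 1" using q by (intro power_le_one) auto
  ultimately have "0 \<le> qbracket (q\<^sup>2) (int k)"
    by (simp add: qbracket_def power_mult)
  then have 2: "\<bar>qbracket (q\<^sup>2) (int k) * (qbracket q (int k))\<^sup>2\<bar> =
      (1 - q ^ (2 * k)) * (1 - q ^ k)\<^sup>2 / ((1 - q\<^sup>2) * (1 - q)\<^sup>2)"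
    by (simp add: abs_mult) (simp add: qbracket_def power_divide power_mult)
  show ?thesis
    unfolding weight_def 1 2 qbinomial_central by (simp add: mult_ac)
qed

lemma sum_even_symmetric_interval:
  fixes f :: "int \<Rightarrow> real"
  assumes "\<And>a. f (- a) = f a" and "f 0 = 0"
  shows "(\<Sum>a = - int n..int n. f a) = 2 * (\<Sum>k = 1..n. f (int k))"
proof (induction n)
  case (Suc n)
  have "{- int (Suc n)..int (Suc n)} = insert (int (Suc n)) (insert (- int (Suc n)) {- int n..int n})"
    by auto
  then show ?case using Suc assms(1)[of "int (Suc n)"] by (simp del: of_nat_Suc)
qed (simp add: assms)

text \<open>The weight is even and so is \<open>node\<close>; hence the sum is twice the sum over positive indices, where
  the shift polynomials lower \<open>n\<close> and \<open>m\<close> to \<open>n - i\<close> and \<open>m - j\<close>.\<close>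

lemma moment:
  assumes q: "0 < q" "q < 1" and i: "i < n" and j: "j < m"
  shows "(\<Sum>a = - int n..int n. weight q n m a * poly (shift_poly q n i) (node q a) * poly (shift_poly q m j) (node q a)) =
    2 * qpoch q q (2 * n) * qpoch q q (2 * m) / (q * (1 - q\<^sup>2) * (1 - q)) *
    (1 / (qpoch q q (n - i - 1))\<^sup>2 * (1 / (qpoch q q (m - j - 1))\<^sup>2) *
     (qpoch q q (n + m - i - j - 1 - 1) / qpoch q q (n + m - i - j)))"
proof -
  let ?A = "recip_qfact_pair q"
  let ?C = "qpoch q q (2 * n) * qpoch q q (2 * m) / ((1 - q\<^sup>2) * (1 - q)\<^sup>2)"
  define n' m' where "n' = n - i - 1" and "m' = m - j - 1"
  have n: "n - i = Suc n'" and m: "m - j = Suc m'" and nn: "Suc n' \<le> n"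
    using i j by (auto simp: n'_def m'_def)
  have node: "node q (int k) = q ^ k + 1 / q ^ k" for k
    by (simp add: node_def power_int_minus field_simps)
  have "(\<Sum>a = - int n..int n. weight q n m a * poly (shift_poly q n i) (node q a) * poly (shift_poly q m j) (node q a)) =
      2 * (\<Sum>k = 1..n. weight q n m (int k) * poly (shift_poly q n i) (node q (int k)) * poly (shift_poly q m j) (node q (int k)))"
    by (rule sum_even_symmetric_interval) (simp_all add: weight_minus[OF q(1)] weight_0, simp add: node_def add.commute)
  also have "(\<Sum>k = 1..n. weight q n m (int k) * poly (shift_poly q n i) (node q (int k)) * poly (shift_poly q m j) (node q (int k))) =
      (\<Sum>k = 1..n. ?C * (q ^ (k * (k - 1)) * (1 - q ^ (2 * k)) * ((1 - q ^ k)\<^sup>2 / q ^ k) * ?A (Suc n') k * ?A (Suc m') k))"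
  proof (intro sum.cong refl)
    fix k assume "k \<in> {1..n}"
    then have k: "k \<ge> 1" by simp
    have "?A (Suc n') k = poly (shift_poly q n i) (node q (int k)) * ?A n k"
      using shift_poly_recip_qfact_pair[OF q, of i n k] i unfolding n node by simp
    moreover have "?A (Suc m') k = poly (shift_poly q m j) (node q (int k)) * ?A m k"
      using shift_poly_recip_qfact_pair[OF q, of j m k] j unfolding m node by simp
    ultimately show "weight q n m (int k) * poly (shift_poly q n i) (node q (int k)) * poly (shift_poly q m j) (node q (int k)) =
        ?C * (q ^ (k * (k - 1)) * (1 - q ^ (2 * k)) * ((1 - q ^ k)\<^sup>2 / q ^ k) * ?A (Suc n') k * ?A (Suc m') k)"
      unfolding weight_nat[OF q k] by (simp only: mult_ac)
  qed
  also have "\<dots> = ?C * ((1 - q) / (q * (qpoch q q n')\<^sup>2 * (qpoch q q m')\<^sup>2 *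
           ((1 - q ^ (n' + m' + 2)) * (1 - q ^ (n' + m' + 1)))))"
    by (simp only: sum_distrib_left[symmetric] base_moment[OF q nn])
  finally have eq: "(\<Sum>a = - int n..int n. weight q n m a * poly (shift_poly q n i) (node q a) * poly (shift_poly q m j) (node q a)) =
      2 * (?C * ((1 - q) / (q * (qpoch q q n')\<^sup>2 * (qpoch q q m')\<^sup>2 *
           ((1 - q ^ (n' + m' + 2)) * (1 - q ^ (n' + m' + 1))))))" .
  have quot: "qpoch q q (n + m - i - j - 1 - 1) / qpoch q q (n + m - i - j) =
      1 / ((1 - q ^ (n' + m' + 2)) * (1 - q ^ (n' + m' + 1)))"
  proof -
    have "n + m - i - j - 1 - 1 = n' + m'" "n + m - i - j = Suc (Suc (n' + m'))"
      using i j by (auto simp: n'_def m'_def)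
    moreover have "qpoch q q (n' + m') \<noteq> 0"
      using qpoch_q_pos[OF q, of "n' + m'"] by simp
    ultimately show ?thesis by (simp add: qpoch_q_Suc)
  qed
  have "2 * (c / (a * d\<^sup>2) * (d / (q * P * R * D))) = 2 * c / (q * a * d) * (1 / P * (1 / R) * (1 / D))"
    if "d \<noteq> 0" for a c d P R D :: real
    using that by (simp add: power2_eq_square)
  from this[of "1 - q" "qpoch q q (2 * n) * qpoch q q (2 * m)"] show ?thesis
    using q unfolding eq quot n'_def[symmetric] m'_def[symmetric] by (simp only: mult.assoc)
qed

definition node_density :: "real \<Rightarrow> nat \<Rightarrow> nat \<Rightarrow> nat \<Rightarrow> (nat \<Rightarrow> int) \<Rightarrow> real" where
  "node_density q n m r k =
     (\<Prod>j<r. \<Prod>i<j. node q (k j) - node q (k i))\<^sup>2 * (\<Prod>i<r. weight q n m (k i))"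

lemma prod_increasing_pairs:
  fixes f :: "nat \<Rightarrow> nat \<Rightarrow> 'a :: comm_monoid_mult"
  shows "(\<Prod>(i, j) \<in> {(i, j). 1 \<le> i \<and> i < j \<and> j \<le> r}. f i j) = (\<Prod>j<r. \<Prod>i<j. f (Suc i) (Suc j))"
proof -
  have "(\<Prod>j<r. \<Prod>i<j. f (Suc i) (Suc j)) = (\<Prod>(j, i)\<in>(SIGMA j:{..<r}. {..<j}). f (Suc i) (Suc j))"
    by (rule prod.Sigma) auto
  also have "\<dots> = (\<Prod>(i, j) \<in> {(i, j). 1 \<le> i \<and> i < j \<and> j \<le> r}. f i j)"
    by (rule prod.reindex_bij_witness[of _ "\<lambda>(i, j). (j - 1, i - 1)" "\<lambda>(j, i). (Suc i, Suc j)"]) auto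
  finally show ?thesis ..
qed

lemma summand_eq_node_density:
  assumes q: "0 < q" "q < 1"
  shows "(\<Prod>(i, j) \<in> {(i, j). 1 \<le> i \<and> i < j \<and> j \<le> r}.
                   (qbracket q (k j - k i))\<^sup>2 * (qbracket q (k i + k j))\<^sup>2)
              * (\<Prod>i = 1..r.
                   q powi ((k i)\<^sup>2 - 2 * int i * k i)
                 * \<bar>qbracket (q\<^sup>2) (k i) * (qbracket q (k i))\<^sup>2\<bar>
                 * qbinomial q (2 * int n) (int n + k i)
                 * qbinomial q (2 * int m) (int m + k i)) =
         node_density q n m r (\<lambda>i. k (Suc i)) / (1 - q) ^ (2 * (r * (r - 1)))"
proof -
  let ?b = "\<lambda>i. k (Suc i)"
  have qp: "q powi ((?b j)\<^sup>2 - 2 * int (Suc j) * ?b j) * (q powi ?b j) ^ (2 * j) = q powi ((?b j)\<^sup>2 - 2 * ?b j)" for j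
  proof -
    have e1: "(q powi ?b j) ^ (2 * j) = q powi (?b j * int (2 * j))"
      by (simp only: power_int_mult power_int_of_nat)
    have e2: "(?b j)\<^sup>2 - 2 * int (Suc j) * ?b j + ?b j * int (2 * j) = (?b j)\<^sup>2 - 2 * ?b j"
      by (simp add: algebra_simps)
    have e3: "q powi x * q powi y = q powi (x + y)" for x y
      using q by (simp add: power_int_add)
    show ?thesis
      unfolding e1 e3 e2 ..
  qed
  have pairs: "(\<Prod>(i, j) \<in> {(i, j). 1 \<le> i \<and> i < j \<and> j \<le> r}.
                   (qbracket q (k j - k i))\<^sup>2 * (qbracket q (k i + k j))\<^sup>2) =
      (\<Prod>j<r. (q powi ?b j) ^ (2 * j)) * (\<Prod>j<r. \<Prod>i<j. node q (?b j) - node q (?b i))\<^sup>2 / (1 - q) ^ (2 * (r * (r - 1)))"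
  proof -
    have "(\<Prod>i<j. (qbracket q (?b j - ?b i))\<^sup>2 * (qbracket q (?b i + ?b j))\<^sup>2) =
        (q powi ?b j) ^ (2 * j) * (\<Prod>i<j. node q (?b j) - node q (?b i))\<^sup>2 / (1 - q) ^ (4 * j)" for j
      using q by (subst qbracket_pair)
        (simp_all add: prod.distrib prod_dividef prod_power_distrib power_mult power_mult_distrib)
    moreover have "(\<Prod>j<r. (1 - q) ^ (4 * j)) = (1 - q) ^ (2 * (r * (r - 1)))"
    proof (induction r)
      case (Suc r)
      have "2 * (r * (r - 1)) + 4 * r = 2 * (Suc r * (Suc r - 1))"
        by (cases r) auto
      have "(\<Prod>j<Suc r. (1 - q) ^ (4 * j)) = (1 - q) ^ (2 * (r * (r - 1)) + 4 * r)"
        using Suc by (simp only: prod.lessThan_Suc power_add)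
      then show ?case
        by (simp only: \<open>2 * (r * (r - 1)) + 4 * r = _\<close>)
    qed simp
    ultimately show ?thesis
      unfolding prod_increasing_pairs by (simp add: prod.distrib prod_dividef prod_power_distrib)
  qed
  have "(\<Prod>i = 1..r. q powi ((k i)\<^sup>2 - 2 * int i * k i) * \<bar>qbracket (q\<^sup>2) (k i) * (qbracket q (k i))\<^sup>2\<bar>
                 * qbinomial q (2 * int n) (int n + k i) * qbinomial q (2 * int m) (int m + k i)) =
      (\<Prod>j<r. q powi ((?b j)\<^sup>2 - 2 * int (Suc j) * ?b j) * \<bar>qbracket (q\<^sup>2) (?b j) * (qbracket q (?b j))\<^sup>2\<bar>
                 * qbinomial q (2 * int n) (int n + ?b j) * qbinomial q (2 * int m) (int m + ?b j))"
    by (simp only: One_nat_def prod.atLeast1_atMost_eq)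
  moreover have "(\<Prod>j<r. (q powi ?b j) ^ (2 * j)) * \<dots> = (\<Prod>i<r. weight q n m (?b i))"
    unfolding prod.distrib[symmetric] weight_def qp[symmetric]
    by (intro prod.cong refl) (simp only: mult_ac)
  ultimately show ?thesis
    unfolding pairs node_density_def by (simp add: mult_ac)
qed

lemma sum_PiE_shift_index:
  assumes "\<And>k k'. (\<And>i. i < r \<Longrightarrow> k i = k' i) \<Longrightarrow> G k = G k'"
  shows "(\<Sum>k \<in> {1..r} \<rightarrow>\<^sub>E K. G (\<lambda>i. k (Suc i))) = (\<Sum>k \<in> {0..<r} \<rightarrow>\<^sub>E K. G k)"
proof (rule sum.reindex_bij_witness
    [of _ "\<lambda>k. \<lambda>i\<in>{1..r}. k (i - 1)" "\<lambda>k. \<lambda>i\<in>{0..<r}. k (Suc i)"])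
  show "G (\<lambda>i\<in>{0..<r}. k (Suc i)) = G (\<lambda>i. k (Suc i))" for k
    by (rule assms) auto
qed (auto simp: PiE_iff fun_eq_iff extensional_def restrict_def)

text \<open>Choosing the shift polynomials of \<open>n\<close> as one basis and those of \<open>m\<close> as the other makes every
  moment explicit, and up to row and column factors the moment depends on \<open>i + j\<close> only.  The power of
  \<open>q\<close> on the left-hand side is the product of all leading coefficients; their signs cancel
  between the two bases.\<close>

lemma sum_node_density:
  assumes q: "0 < q" "q < 1" and r: "r \<le> n" "r \<le> m"
  shows "(\<Sum>k \<in> {0..<r} \<rightarrow>\<^sub>E {- int n..int n}. node_density q n m r k) *
      q ^ (\<Sum>j<r. \<Sum>l<j. (n - l) + (m - l)) =
    fact r * (2 * qpoch q q (2 * n) * qpoch q q (2 * m) / (q * (1 - q\<^sup>2) * (1 - q))) ^ r *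
    (\<Prod>i<r. 1 / (qpoch q q (n - i - 1))\<^sup>2) * (\<Prod>i<r. 1 / (qpoch q q (m - i - 1))\<^sup>2) *
    (q ^ (\<Sum>i<r. i * (n + m - 2 * r + i)) *
     (\<Prod>i<r. qpoch q q i * qpoch q q (Suc i) / (1 - q) *
       (qpoch q q (n + m - i - r - 1) / qpoch q q (n + m - i))))"
proof -
  let ?V = "\<lambda>k. \<Prod>j<r. \<Prod>i<j. node q (k j) - node q (k i)"
  define L where "L n = (\<Prod>j<r. coeff (shift_poly q n j) j)" for n
  let ?c = "2 * qpoch q q (2 * n) * qpoch q q (2 * m) / (q * (1 - q\<^sup>2) * (1 - q))"
  have det: "arr_det r (\<lambda>i j. poly (shift_poly q n j) (node q (k i))) = L n * ?V k" for n k
    unfolding L_def by (rule arr_det_poly[of r "shift_poly q n" "\<lambda>i. node q (k i)"])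
      (simp add: degree_coeff_shift_poly[OF q(1)])
  have L: "L n * L m = q ^ (\<Sum>j<r. \<Sum>l<j. (n - l) + (m - l))"
    unfolding L_def degree_coeff_shift_poly[OF q(1)] prod.distrib[symmetric]
    by (simp add: power_sum power_add)
  have "(\<Sum>k \<in> {0..<r} \<rightarrow>\<^sub>E {- int n..int n}. node_density q n m r k) * (L n * L m) =
     (\<Sum>k \<in> {0..<r} \<rightarrow>\<^sub>E {- int n..int n}. (\<Prod>i = 0..<r. weight q n m (k i)) *
        arr_det r (\<lambda>i j. poly (shift_poly q n j) (node q (k i))) *
        arr_det r (\<lambda>i j. poly (shift_poly q m j) (node q (k i))))"
    unfolding det node_density_def sum_distrib_right lessThan_atLeast0
    by (intro sum.cong refl) (simp only: power2_eq_square mult_ac)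
  also have "\<dots> = of_nat (fact r) * arr_det r (\<lambda>i j. \<Sum>a = - int n..int n. weight q n m a *
      poly (shift_poly q n i) (node q a) * poly (shift_poly q m j) (node q a))"
    by (rule andreief) simp
  also have "arr_det r (\<lambda>i j. \<Sum>a = - int n..int n. weight q n m a *
      poly (shift_poly q n i) (node q a) * poly (shift_poly q m j) (node q a)) =
    arr_det r (\<lambda>i j. (?c * (1 / (qpoch q q (n - i - 1))\<^sup>2)) * (1 / (qpoch q q (m - j - 1))\<^sup>2) *
     (qpoch q q (n + m - i - j - 1 - 1) / qpoch q q (n + m - i - j)))"
    by (rule arr_det_cong) (use r in \<open>simp add: moment[OF q]\<close>)
  also have "\<dots> = (\<Prod>i<r. ?c * (1 / (qpoch q q (n - i - 1))\<^sup>2)) * (\<Prod>j<r. 1 / (qpoch q q (m - j - 1))\<^sup>2) *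
     arr_det r (\<lambda>i j. qpoch q q (n + m - i - j - 1 - 1) / qpoch q q (n + m - i - j))"
    by (rule arr_det_scale)
  also have "arr_det r (\<lambda>i j. qpoch q q (n + m - i - j - 1 - 1) / qpoch q q (n + m - i - j)) =
    q ^ (\<Sum>i<r. i * (n + m - 2 * r + i)) *
     (\<Prod>i<r. qpoch q q i * qpoch q q (Suc i) / (1 - q) *
       (qpoch q q (n + m - i - r - 1) / qpoch q q (n + m - i)))"
  proof -
    have "qpoch q q 1 = 1 - q" by (simp add: qpoch_def)
    then show ?thesis using hankel_det[OF q, of r 1 "n + m"] r by simp
  qed
  also have "(\<Prod>i<r. ?c * (1 / (qpoch q q (n - i - 1))\<^sup>2)) = ?c ^ r * (\<Prod>i<r. 1 / (qpoch q q (n - i - 1))\<^sup>2)"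
    by (simp only: prod.distrib prod_constant card_lessThan)
  finally show ?thesis unfolding L by (simp only: of_nat_fact mult.assoc)
qed

text \<open>The weight vanishes unless \<open>1 \<le> \<bar>k i\<bar> \<le> min n m\<close>, and the Vandermonde product vanishes if two
  of the \<open>\<bar>k i\<bar>\<close> coincide.\<close>

lemma node_density_eq_0:
  assumes small: "n < r \<or> m < r"
  shows "node_density q n m r k = 0"
proof (rule ccontr)
  assume nz: "node_density q n m r k \<noteq> 0"
  have w: "weight q n m (k i) \<noteq> 0" if "i < r" for i
    using nz that by (auto simp: node_density_def)
  have "nat \<bar>k i\<bar> \<in> {1..min n m}" if "i < r" for i
  proof -
    have "k i \<noteq> 0" using w[OF that] weight_0[of q n m] by metis
    moreover have "nat \<bar>k i\<bar> \<le> n" "nat \<bar>k i\<bar> \<le> m"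
      using w[OF that] unfolding weight_def qbinomial_central recip_qfact_pair_def by (auto split: if_splits)
    ultimately show ?thesis by auto
  qed
  then have "(\<lambda>i. nat \<bar>k i\<bar>) ` {..<r} \<subseteq> {1..min n m}" by blast
  moreover have "card {1..min n m} < card {..<r}" using small by auto
  ultimately have "\<not> inj_on (\<lambda>i. nat \<bar>k i\<bar>) {..<r}"
    using card_inj_on_le[of _ "{..<r}" "{1..min n m}"] by (metis finite_atLeastAtMost leD)
  then obtain i j where ij: "i < j" "j < r" "nat \<bar>k i\<bar> = nat \<bar>k j\<bar>"
    unfolding inj_on_def by (metis lessThan_iff linorder_neqE_nat)
  then have "k i = k j \<or> k i = - k j" by linarith
  then have "node q (k j) - node q (k i) = 0" by (auto simp: node_def)
  then have "(\<Prod>i<j. node q (k j) - node q (k i)) = 0" using ij by (auto intro!: prod_zero)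
  then have "(\<Prod>j<r. \<Prod>i<j. node q (k j) - node q (k i)) = 0" using ij by (auto intro!: prod_zero)
  with nz show False by (simp add: node_density_def)
qed

section \<open>Zeros and poles of the q-gamma function\<close>

lemma convergent_prod_qpoch:
  assumes "0 < q" "q < 1"
  shows "convergent_prod (\<lambda>j. 1 - a * q ^ j :: real)"
proof (rule abs_convergent_prod_imp_convergent_prod)
  have "summable (\<lambda>j. norm a * q ^ j)"
    using assms by (intro summable_mult summable_geometric) auto
  then show "abs_convergent_prod (\<lambda>j. 1 - a * q ^ j)"
    unfolding abs_convergent_prod_conv_summable using assms by (simp add: abs_mult)
qed

lemma qpoch_tendsto_qpoch_inf:
  assumes "0 < q" "q < 1"
  shows "(\<lambda>n. qpoch a q (Suc n)) \<longlonglongrightarrow> qpoch_inf a q"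
  using convergent_prod_LIMSEQ[OF convergent_prod_qpoch[OF assms, of a]]
  by (simp add: qpoch_def qpoch_inf_def lessThan_Suc_atMost)

lemma qpoch_shift: "qpoch a q (Suc k) = (1 - a) * qpoch (a * q) q k"
  unfolding qpoch_def by (subst prod.lessThan_Suc_shift) (simp add: mult_ac)

lemma qpoch_inf_shift:
  assumes "0 < q" "q < 1"
  shows "qpoch_inf a q = (1 - a) * qpoch_inf (a * q) q"
proof (rule LIMSEQ_unique)
  show "(\<lambda>n. qpoch a q (Suc (Suc n))) \<longlonglongrightarrow> qpoch_inf a q"
    using qpoch_tendsto_qpoch_inf[OF assms] by (rule LIMSEQ_Suc)
  show "(\<lambda>n. qpoch a q (Suc (Suc n))) \<longlonglongrightarrow> (1 - a) * qpoch_inf (a * q) q"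
    unfolding qpoch_shift[of a q "Suc _"] by (intro tendsto_mult_left qpoch_tendsto_qpoch_inf assms)
qed

lemma qpoch_inf_pos:
  assumes "0 < q" "q < 1" "a < 1"
  shows "0 < qpoch_inf a q"
proof -
  have pos: "0 < 1 - a * q ^ j" for j
  proof (cases "a \<le> 0")
    case True
    then have "a * q ^ j \<le> 0" using assms by (simp add: mult_nonpos_nonneg)
    then show ?thesis by simp
  next
    case False
    then have "a * q ^ j \<le> a * 1" using assms by (intro mult_left_mono power_le_one) auto
    then show ?thesis using assms by simp
  qed
  have "qpoch_inf a q \<noteq> 0"
    unfolding qpoch_inf_def
    by (intro prodinf_nonzero convergent_prod_qpoch assms less_imp_neq[THEN not_sym] pos)
  moreover have "0 \<le> qpoch_inf a q"
  proof (rule LIMSEQ_le_const[OF qpoch_tendsto_qpoch_inf[OF assms(1,2)]])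
    have "0 \<le> qpoch a q k" for k
      unfolding qpoch_def by (intro prod_nonneg ballI less_imp_le pos)
    then show "\<exists>N. \<forall>n\<ge>N. 0 \<le> qpoch a q (Suc n)" by blast
  qed
  ultimately show ?thesis by simp
qed

lemma qpoch_inf_antimono:
  assumes "0 < q" "q < 1" "a \<le> b" "b \<le> 1"
  shows "qpoch_inf b q \<le> qpoch_inf a q"
proof (rule LIMSEQ_le[OF qpoch_tendsto_qpoch_inf qpoch_tendsto_qpoch_inf])
  have "0 \<le> 1 - b * q ^ j \<and> 1 - b * q ^ j \<le> 1 - a * q ^ j" for j
  proof -
    have "b * q ^ j \<le> 1 * q ^ j" "a * q ^ j \<le> b * q ^ j" "q ^ j \<le> 1"
      using assms by (auto intro!: mult_right_mono power_le_one)
    then show ?thesis by linarith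
  qed
  then show "\<exists>N. \<forall>n\<ge>N. qpoch b q (Suc n) \<le> qpoch a q (Suc n)"
    unfolding qpoch_def by (intro exI allI impI prod_mono) auto
qed (use assms in auto)

lemma qGamma_recurrence:
  assumes "0 < q" "q < 1" "x \<noteq> 0"
  shows "qGamma q (x + 1) = (1 - q powr x) / (1 - q) * qGamma q x"
proof -
  have "q powr x \<noteq> 1" using assms by (simp add: powr_def)
  moreover have "qpoch_inf (q powr x) q = (1 - q powr x) * qpoch_inf (q powr (x + 1)) q"
    using qpoch_inf_shift[OF assms(1,2), of "q powr x"] assms by (simp add: powr_add)
  moreover have "(1 - q) powr (1 - x) = (1 - q) powr (1 - (x + 1)) * (1 - q)"
    using assms by (simp add: powr_diff powr_minus field_simps)
  ultimately show ?thesis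
    using assms by (cases "qpoch_inf (q powr (x + 1)) q = 0") (auto simp: qGamma_def divide_simps)
qed

lemma qGamma_nonpos_int:
  assumes "0 < q" "q < 1"
  shows "qGamma q (- real k) = 0"
proof -
  have "qpoch_inf (q powr (- real k)) q = 0"
  proof (induction k)
    case 0
    then show ?case using qpoch_inf_shift[OF assms, of 1] assms by simp
  next
    case (Suc k)
    have "q powr (- real (Suc k)) * q = q powr (- real k)"
      using assms by (simp add: powr_diff powr_minus divide_simps powr_add)
    then show ?case
      using qpoch_inf_shift[OF assms, of "q powr (- real (Suc k))"] Suc by simp
  qed
  then show ?thesis by (simp add: qGamma_def)
qed

lemma qGamma_1:
  assumes "0 < q" "q < 1"
  shows "qGamma q 1 = 1"
  using qpoch_inf_pos[OF assms, of q] assms by (simp add: qGamma_def)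

lemma qGamma_nat:
  assumes "0 < q" "q < 1"
  shows "qGamma q (real k + 1) = qpoch q q k / (1 - q) ^ k"
proof (induction k)
  case (Suc k)
  have "qGamma q (real (Suc k) + 1) = (1 - q powr real (Suc k)) / (1 - q) * qGamma q (real k + 1)"
    using qGamma_recurrence[OF assms, of "real (Suc k)"] by (simp add: add.commute)
  also have "q powr real (Suc k) = q ^ Suc k"
    using assms by (intro powr_realpow) auto
  finally show ?case
    using Suc by (simp add: qpoch_q_Suc mult_ac)
qed (use qGamma_1[OF assms] in simp)

lemma bigtheta_divide_filter:
  fixes f1 f2 g1 g2 :: "'a \<Rightarrow> real"
  assumes "f1 \<in> \<Theta>[F](f2)" and "g1 \<in> \<Theta>[F](g2)"
  shows "(\<lambda>x. f1 x / g1 x) \<in> \<Theta>[F](\<lambda>x. f2 x / g2 x)"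
  unfolding divide_inverse
  by (rule landau_theta.mult[OF assms(1)]) (simp only: bigtheta_inverse assms(2))

text \<open>Two-sided bounds are enough for orders of growth, and they follow from the monotonicity of
  \<open>qpoch_inf\<close> in its first argument.\<close>

lemma qGamma_bigtheta_near_1:
  assumes q: "0 < q" "q < 1"
  shows "(\<lambda>\<epsilon>. qGamma q (1 + c * \<epsilon>)) \<in> \<Theta>[at 0](\<lambda>_. 1)"
proof -
  define A where "A = qpoch_inf q q"
  define B where "B = qpoch_inf (q powr (1 / 2)) q"
  have half: "q powr (1 / 2) < 1" using q by (simp add: powr_def)
  have A: "A > 0" and B: "B > 0" unfolding A_def B_def using q half qpoch_inf_pos by auto
  have "((\<lambda>\<epsilon>. 1 + c * \<epsilon>) \<longlongrightarrow> 1 + c * 0) (at 0)"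
    by (intro tendsto_intros)
  then have ev: "eventually (\<lambda>\<epsilon>. 1 + c * \<epsilon> > 1 / 2) (at 0)"
    by (rule order_tendstoD) auto
  have bounds: "eventually (\<lambda>\<epsilon>. B \<le> qpoch_inf (q powr (1 + c * \<epsilon>)) q \<and> qpoch_inf (q powr (1 + c * \<epsilon>)) q \<le> 1) (at 0)"
    using ev
  proof eventually_elim
    case (elim \<epsilon>)
    have "q powr (1 + c * \<epsilon>) \<le> q powr (1 / 2)"
      using q elim by (intro powr_mono') auto
    then have "B \<le> qpoch_inf (q powr (1 + c * \<epsilon>)) q"
      unfolding B_def using q half by (intro qpoch_inf_antimono) auto
    moreover have "qpoch_inf (q powr (1 + c * \<epsilon>)) q \<le> qpoch_inf 0 q"
      using q half \<open>q powr (1 + c * \<epsilon>) \<le> _\<close> by (intro qpoch_inf_antimono) auto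
    moreover have "qpoch_inf 0 q = 1" by (simp add: qpoch_inf_def)
    ultimately show ?case by simp
  qed
  have "(\<lambda>\<epsilon>. qpoch_inf (q powr (1 + c * \<epsilon>)) q) \<in> \<Theta>[at 0](\<lambda>_. 1)"
    by (rule bigthetaI'[of B 1]) (use B bounds in \<open>auto elim!: eventually_mono\<close>)
  moreover have "(\<lambda>\<epsilon>. (1 - q) powr (1 - (1 + c * \<epsilon>)) * A) \<in> \<Theta>[at 0](\<lambda>_. 1)"
  proof (rule bigthetaI_tendsto)
    have "((\<lambda>\<epsilon>. (1 - q) powr (1 - (1 + c * \<epsilon>)) * A / 1) \<longlongrightarrow> (1 - q) powr (1 - (1 + c * 0)) * A / 1) (at 0)"
      using q by (intro tendsto_intros) auto
    then show "((\<lambda>\<epsilon>. (1 - q) powr (1 - (1 + c * \<epsilon>)) * A / 1) \<longlongrightarrow> A) (at 0)"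
      using q by simp
  qed (use A in simp)
  ultimately have "(\<lambda>\<epsilon>. (1 - q) powr (1 - (1 + c * \<epsilon>)) * A / qpoch_inf (q powr (1 + c * \<epsilon>)) q) \<in> \<Theta>[at 0](\<lambda>_. 1 / 1)"
    by (intro bigtheta_divide_filter)
  then show ?thesis by (simp add: qGamma_def A_def)
qed

text \<open>The \<open>q\<close>-gamma function has simple poles at the integers \<open>z \<le> 0\<close> and is finite and nonzero at the
  integers \<open>z \<ge> 1\<close>.  The recurrence transports the order of growth from \<open>z = 1\<close> to all integers;
  only the passage from \<open>1\<close> to \<open>0\<close> divides by a factor that tends to \<open>0\<close>.\<close>

lemma qGamma_bigtheta:
  assumes q: "0 < q" "q < 1" and c: "c \<noteq> 0"
  shows "(\<lambda>\<epsilon>. qGamma q (of_int z + c * \<epsilon>)) \<in> \<Theta>[at 0](\<lambda>\<epsilon>. if z \<le> 0 then 1 / \<epsilon> else 1)"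
proof -
  let ?b = "\<lambda>z \<epsilon>. (1 - q powr (of_int z + c * \<epsilon>)) / (1 - q)"
  have b_nonzero: "?b z \<in> \<Theta>[at 0](\<lambda>_. 1)" if "z \<noteq> 0" for z :: int
  proof (rule bigthetaI_tendsto)
    have "((\<lambda>\<epsilon>. ?b z \<epsilon> / 1) \<longlongrightarrow> ?b z 0 / 1) (at 0)"
      using q by (intro tendsto_intros) auto
    then show "((\<lambda>\<epsilon>. ?b z \<epsilon> / 1) \<longlongrightarrow> (1 - q powr of_int z) / (1 - q)) (at 0)"
      by simp
    show "(1 - q powr of_int z) / (1 - q) \<noteq> 0"
      using q that by (simp add: powr_def)
  qed
  have b_zero: "?b 0 \<in> \<Theta>[at 0](\<lambda>\<epsilon>. \<epsilon>)"
  proof (rule bigthetaI_tendsto)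
    have "((\<lambda>\<epsilon>. q powr (c * \<epsilon>)) has_real_derivative c * ln q) (at 0)"
      using q by (auto intro!: derivative_eq_intros)
    then have "((\<lambda>\<epsilon>. (q powr (c * \<epsilon>) - 1) / \<epsilon>) \<longlongrightarrow> c * ln q) (at 0)"
      using q by (simp add: has_field_derivative_iff)
    then have "((\<lambda>\<epsilon>. - ((q powr (c * \<epsilon>) - 1) / \<epsilon>) / (1 - q)) \<longlongrightarrow> - (c * ln q) / (1 - q)) (at 0)"
      using q by (intro tendsto_intros) auto
    moreover have "- ((Q - 1) / \<epsilon>) / (1 - q) = (1 - Q) / (1 - q) / \<epsilon>" for Q \<epsilon> :: real
    proof -
      have "- ((Q - 1) / \<epsilon>) = (1 - Q) / \<epsilon>"
        by (simp only: minus_divide_left minus_diff_eq)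
      then show ?thesis
        by (simp only: divide_divide_eq_left mult.commute)
    qed
    ultimately show "((\<lambda>\<epsilon>. ?b 0 \<epsilon> / \<epsilon>) \<longlongrightarrow> - (c * ln q) / (1 - q)) (at 0)"
      by simp
    show "- (c * ln q) / (1 - q) \<noteq> 0" using q c by simp
  qed
  have ev_nz: "eventually (\<lambda>\<epsilon>. of_int z + c * \<epsilon> \<noteq> 0) (at 0)" for z :: int
  proof (cases "z = 0")
    case True
    then show ?thesis using c by (auto simp: eventually_at_filter)
  next
    case False
    have "((\<lambda>\<epsilon>. of_int z + c * \<epsilon>) \<longlongrightarrow> of_int z + c * 0) (at 0)"
      by (intro tendsto_intros)
    then show ?thesis
      by (rule tendsto_imp_eventually_ne) (use False in simp)
  qed
  have rec: "eventually (\<lambda>\<epsilon>. qGamma q (of_int (z + 1) + c * \<epsilon>) = ?b z \<epsilon> * qGamma q (of_int z + c * \<epsilon>)) (at 0)" for z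
    using ev_nz[of z]
  proof eventually_elim
    case (elim \<epsilon>)
    show ?case using qGamma_recurrence[OF q elim] by (simp add: add_ac)
  qed
  have pos: "(\<lambda>\<epsilon>. qGamma q (of_int z + c * \<epsilon>)) \<in> \<Theta>[at 0](\<lambda>_. 1)" if "z \<ge> 1" for z
    using that
  proof (induction z rule: int_ge_induct)
    case base
    then show ?case using qGamma_bigtheta_near_1[OF q, of c] by simp
  next
    case (step z)
    have "(\<lambda>\<epsilon>. ?b z \<epsilon> * qGamma q (of_int z + c * \<epsilon>)) \<in> \<Theta>[at 0](\<lambda>_. 1 * 1)"
      using step by (intro landau_theta.mult b_nonzero) auto
    then show ?case
      using landau_theta.in_cong[OF rec[of z]] by simp
  qed
  \<comment> \<open>One step downwards in the recurrence: the order is divided by that of the factor \<open>?b z\<close>.\<close>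
  have down: "(\<lambda>\<epsilon>. qGamma q (of_int z + c * \<epsilon>)) \<in> \<Theta>[at 0](\<lambda>\<epsilon>. g \<epsilon> / h \<epsilon>)"
    if "(\<lambda>\<epsilon>. qGamma q (of_int (z + 1) + c * \<epsilon>)) \<in> \<Theta>[at 0](g)" "?b z \<in> \<Theta>[at 0](h)"
    for z g h
  proof -
    have nz: "eventually (\<lambda>\<epsilon>. ?b z \<epsilon> \<noteq> 0) (at 0)"
      using ev_nz[of z] by eventually_elim (use q in \<open>simp add: powr_def\<close>)
    have "(\<lambda>\<epsilon>. qGamma q (of_int (z + 1) + c * \<epsilon>) / ?b z \<epsilon>) \<in> \<Theta>[at 0](\<lambda>\<epsilon>. g \<epsilon> / h \<epsilon>)"
      by (intro bigtheta_divide_filter that)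
    moreover have "eventually (\<lambda>\<epsilon>. qGamma q (of_int (z + 1) + c * \<epsilon>) / ?b z \<epsilon> = qGamma q (of_int z + c * \<epsilon>)) (at 0)"
      using rec[of z] nz by eventually_elim simp
    ultimately show ?thesis
      by (subst (asm) landau_theta.in_cong)
  qed
  have neg: "(\<lambda>\<epsilon>. qGamma q (of_int z + c * \<epsilon>)) \<in> \<Theta>[at 0](\<lambda>\<epsilon>. 1 / \<epsilon>)" if "z \<le> 0" for z
    using that
  proof (induction z rule: int_le_induct)
    case base
    show ?case using down[of 0 "\<lambda>_. 1" "\<lambda>\<epsilon>. \<epsilon>"] pos[of 1] b_zero by simp
  next
    case (step z)
    show ?case using down[of "z - 1" "\<lambda>\<epsilon>. 1 / \<epsilon>" "\<lambda>_. 1"] step b_nonzero[of "z - 1"] by simp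
  qed
  show ?thesis using pos[of z] neg[of z] by (cases "z \<le> 0") simp_all
qed

lemma not_is_pole_qGamma:
  assumes q: "0 < q" "q < 1" and z: "z \<ge> 1"
  shows "\<not> is_pole (qGamma q) (of_int z)"
proof
  assume "is_pole (qGamma q) (of_int z)"
  then have "filterlim (\<lambda>\<epsilon>. qGamma q (of_int z + 1 * \<epsilon>)) at_infinity (at 0)"
    unfolding is_pole_def by (subst (asm) filterlim_shift_iff[where d = "of_int z", symmetric]) (simp add: o_def add.commute at_to_0'[symmetric])
  note lim = this
  have "(\<lambda>\<epsilon>. qGamma q (of_int z + 1 * \<epsilon>)) \<in> O[at 0](\<lambda>_. 1)"
    using qGamma_bigtheta[OF q, of 1 z] z by (simp add: bigthetaD1)
  then obtain C where C: "eventually (\<lambda>\<epsilon>. norm (qGamma q (of_int z + 1 * \<epsilon>)) \<le> C) (at 0)"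
    by (elim landau_o.bigE) auto
  have "eventually (\<lambda>\<epsilon>. norm (qGamma q (of_int z + 1 * \<epsilon>)) \<ge> \<bar>C\<bar> + 1) (at 0)"
    using lim unfolding filterlim_at_infinity[OF order_refl] by auto
  with C have "eventually (\<lambda>\<epsilon>::real. False) (at 0)"
    by eventually_elim auto
  then show False by simp
qed

lemma sum_indicator_greater:
  "(\<Sum>i = 1..r. if a < i then 1 else 0 :: int) = int (r - a)"
  by (induction r) (auto simp: Suc_diff_le)

lemma prod_power_int:
  fixes x :: "'a :: field"
  assumes "x \<noteq> 0"
  shows "(\<Prod>i\<in>A. x powi f i) = x powi (\<Sum>i\<in>A. f i)"
  using assms by (induction A rule: infinite_finite_induct) (simp_all add: power_int_add)

text \<open>By \<open>qGamma_bigtheta\<close> the \<open>i\<close>-th factor is of order \<open>\<epsilon>\<close> to the power \<open>e i\<close>, where \<open>e i\<close>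
  counts the zeros minus the poles.  A single factor can have a pole, so only the sum of all \<open>e i\<close>
  is known to be positive: there are \<open>2 (r - n) + 2 (r - m)\<close> zeros (truncated differences) from the
  squared denominators, against at most \<open>r - (m + n - r) \<le> (r - n) + (r - m)\<close> poles.\<close>

lemma gamma_product_tendsto_0:
  assumes q: "0 < q" "q < 1" and less: "n < r \<or> m < r"
  shows "((\<lambda>\<epsilon>. \<Prod>i = 1..r.
            (qGamma q (2 * (real n + \<epsilon>) + 1) / (qGamma q (real n + \<epsilon> - real i + 1))\<^sup>2)
          * (qGamma q (2 * (real m + \<epsilon>) + 1) / (qGamma q (real m + \<epsilon> - real i + 1))\<^sup>2)
          * (qGamma q (real i) * qGamma q (real i + 1)
               * qGamma q (real m + \<epsilon> + (real n + \<epsilon>) - real i - real r + 1)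
             / qGamma q (real m + \<epsilon> + (real n + \<epsilon>) - real i + 2))) \<longlongrightarrow> 0) (at 0)"
    (is "((\<lambda>\<epsilon>. \<Prod>i = 1..r. ?F i \<epsilon>) \<longlongrightarrow> 0) (at 0)")
proof -
  define P where "P z = (if z \<le> 0 then 1 else 0 :: int)" for z :: int
  have gamma: "(\<lambda>\<epsilon>. qGamma q (x + c * \<epsilon>)) \<in> \<Theta>[at 0](\<lambda>\<epsilon>. \<epsilon> powi (- P z))"
    if "c \<noteq> 0" "x = of_int z" for c x z
  proof -
    have "(\<lambda>\<epsilon>::real. if z \<le> 0 then 1 / \<epsilon> else 1) = (\<lambda>\<epsilon>. \<epsilon> powi (- P z))"
      by (auto simp: P_def power_int_minus field_simps)
    with qGamma_bigtheta[OF q that(1), of z] show ?thesis by (simp add: that(2))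
  qed
  \<comment> \<open>Zeros minus poles of the \<open>i\<close>-th factor; \<open>P z\<close> is the order of the pole of the \<open>q\<close>-gamma function at \<open>z\<close>.\<close>
  define e where "e i = 2 * P (int n - int i + 1) + 2 * P (int m - int i + 1)
      - P (int m + int n - int i - int r + 1) + P (int m + int n - int i + 2)" for i
  have F: "?F i \<in> O[at 0](\<lambda>\<epsilon>. \<epsilon> powi e i)" for i
  proof -
    let ?p1 = "P (int n - int i + 1)" and ?p2 = "P (int m - int i + 1)"
      and ?p3 = "P (int m + int n - int i - int r + 1)" and ?p4 = "P (int m + int n - int i + 2)"
    let ?G = "\<lambda>\<epsilon>::real. (\<epsilon> powi (- P (2 * int n + 1)) / (\<epsilon> powi (- ?p1) * \<epsilon> powi (- ?p1)))
        * (\<epsilon> powi (- P (2 * int m + 1)) / (\<epsilon> powi (- ?p2) * \<epsilon> powi (- ?p2)))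
        * (1 * \<epsilon> powi (- ?p3) / \<epsilon> powi (- ?p4))"
    have const: "(\<lambda>_. qGamma q (real i) * qGamma q (real i + 1)) \<in> O[at 0](\<lambda>_. 1)"
      by simp
    have 1: "(\<lambda>\<epsilon>. qGamma q (2 * (real n + \<epsilon>) + 1)) \<in> \<Theta>[at 0](\<lambda>\<epsilon>. \<epsilon> powi (- P (2 * int n + 1)))"
      using gamma[of 2 "2 * real n + 1" "2 * int n + 1"] by (simp add: algebra_simps)
    have 2: "(\<lambda>\<epsilon>. qGamma q (2 * (real m + \<epsilon>) + 1)) \<in> \<Theta>[at 0](\<lambda>\<epsilon>. \<epsilon> powi (- P (2 * int m + 1)))"
      using gamma[of 2 "2 * real m + 1" "2 * int m + 1"] by (simp add: algebra_simps)
    have 3: "(\<lambda>\<epsilon>. qGamma q (real n + \<epsilon> - real i + 1)) \<in> \<Theta>[at 0](\<lambda>\<epsilon>. \<epsilon> powi (- ?p1))"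
      using gamma[of 1 "real n - real i + 1" "int n - int i + 1"] by (simp add: algebra_simps)
    have 4: "(\<lambda>\<epsilon>. qGamma q (real m + \<epsilon> - real i + 1)) \<in> \<Theta>[at 0](\<lambda>\<epsilon>. \<epsilon> powi (- ?p2))"
      using gamma[of 1 "real m - real i + 1" "int m - int i + 1"] by (simp add: algebra_simps)
    have 5: "(\<lambda>\<epsilon>. qGamma q (real m + \<epsilon> + (real n + \<epsilon>) - real i - real r + 1)) \<in> \<Theta>[at 0](\<lambda>\<epsilon>. \<epsilon> powi (- ?p3))"
      using gamma[of 2 "real m + real n - real i - real r + 1" "int m + int n - int i - int r + 1"]
      by (simp add: algebra_simps)
    have 6: "(\<lambda>\<epsilon>. qGamma q (real m + \<epsilon> + (real n + \<epsilon>) - real i + 2)) \<in> \<Theta>[at 0](\<lambda>\<epsilon>. \<epsilon> powi (- ?p4))"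
      using gamma[of 2 "real m + real n - real i + 2" "int m + int n - int i + 2"]
      by (simp add: algebra_simps)
    have A: "(\<lambda>\<epsilon>. (qGamma q (2 * (real n + \<epsilon>) + 1) / (qGamma q (real n + \<epsilon> - real i + 1))\<^sup>2)
          * (qGamma q (2 * (real m + \<epsilon>) + 1) / (qGamma q (real m + \<epsilon> - real i + 1))\<^sup>2))
        \<in> \<Theta>[at 0](\<lambda>\<epsilon>. (\<epsilon> powi (- P (2 * int n + 1)) / (\<epsilon> powi (- ?p1) * \<epsilon> powi (- ?p1)))
        * (\<epsilon> powi (- P (2 * int m + 1)) / (\<epsilon> powi (- ?p2) * \<epsilon> powi (- ?p2))))"
      unfolding power2_eq_square
      by (intro landau_theta.mult bigtheta_divide_filter 1 2 3 4)
    have B: "(\<lambda>\<epsilon>. qGamma q (real m + \<epsilon> + (real n + \<epsilon>) - real i - real r + 1)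
             / qGamma q (real m + \<epsilon> + (real n + \<epsilon>) - real i + 2))
        \<in> \<Theta>[at 0](\<lambda>\<epsilon>. \<epsilon> powi (- ?p3) / \<epsilon> powi (- ?p4))"
      by (intro bigtheta_divide_filter 5 6)
    have "?F i \<in> O[at 0](?G)"
      using landau_o.big.mult[OF bigthetaD1[OF A] landau_o.big.mult[OF const bigthetaD1[OF B]]]
      by (simp only: times_divide_eq_right mult.assoc)
    also have "eventually (\<lambda>\<epsilon>. ?G \<epsilon> = \<epsilon> powi e i) (at 0)"
    proof (rule eventually_at_filter[THEN iffD2], intro always_eventually allI impI)
      fix x :: real assume x: "x \<noteq> 0"
      have "P (2 * int n + 1) = 0" "P (2 * int m + 1) = 0" by (auto simp: P_def)
      moreover have "e i = (?p1 + ?p1) + (?p2 + ?p2) - ?p3 + ?p4"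
        by (simp add: e_def)
      moreover have "x powi ((a + a) + (b + b) - c + d) =
          (1 / (x powi - a * x powi - a)) * (1 / (x powi - b * x powi - b)) * (1 * x powi - c / x powi - d)"
        for a b c d
        by (simp only: power_int_add power_int_diff x not_False_eq_True simp_thms)
          (simp add: power_int_minus field_simps x)
      ultimately show "?G x = x powi e i"
        by simp
    qed
    finally show ?thesis .
  qed
  define E where "E = (\<Sum>i = 1..r. e i)"
  have E: "E \<ge> 1"
  proof -
    have "(\<Sum>i = 1..r. P (int n - int i + 1)) = (\<Sum>i = 1..r. if n < i then 1 else 0)"
      "(\<Sum>i = 1..r. P (int m - int i + 1)) = (\<Sum>i = 1..r. if m < i then 1 else 0)"
      "(\<Sum>i = 1..r. P (int m + int n - int i - int r + 1)) = (\<Sum>i = 1..r. if m + n - r < i then 1 else 0)"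
      by (intro sum.cong; auto simp: P_def)+
    moreover have "(\<Sum>i = 1..r. P (int m + int n - int i + 2)) \<ge> 0"
      by (intro sum_nonneg) (simp add: P_def)
    ultimately have "E \<ge> 2 * int (r - n) + 2 * int (r - m) - int (r - (m + n - r))"
      unfolding E_def e_def sum_indicator_greater
      by (simp add: sum.distrib sum_subtractf flip: sum_distrib_left)
    moreover have "2 * int (r - n) + 2 * int (r - m) - int (r - (m + n - r)) \<ge> 1"
      using less by auto
    ultimately show ?thesis by linarith
  qed
  have "(\<lambda>\<epsilon>. \<Prod>i = 1..r. ?F i \<epsilon>) \<in> O[at 0](\<lambda>\<epsilon>. \<Prod>i = 1..r. \<epsilon> powi e i)"
    by (intro landau_o.big_prod F)
  also have "eventually (\<lambda>\<epsilon>::real. (\<Prod>i = 1..r. \<epsilon> powi e i) = \<epsilon> ^ nat E) (at 0)"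
  proof (rule eventually_at_filter[THEN iffD2], intro always_eventually allI impI)
    fix x :: real assume "x \<noteq> 0"
    then have "(\<Prod>i = 1..r. x powi e i) = x powi E"
      unfolding E_def by (rule prod_power_int)
    then show "(\<Prod>i = 1..r. x powi e i) = x ^ nat E"
      using E by (simp add: power_int_def)
  qed
  also have "(\<lambda>\<epsilon>::real. \<epsilon> ^ nat E) \<in> o[at 0](\<lambda>_. 1)"
  proof (rule smalloI_tendsto)
    have "((\<lambda>\<epsilon>::real. \<epsilon> ^ nat E / 1) \<longlongrightarrow> 0 ^ nat E / 1) (at 0)"
      by (intro tendsto_intros) auto
    then show "((\<lambda>\<epsilon>::real. \<epsilon> ^ nat E / 1) \<longlongrightarrow> 0) (at 0)"
      using E by simp
  qed simp
  finally show ?thesis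
    by (auto dest: smalloD_tendsto)
qed

section \<open>Comparison of the two sides\<close>

lemma sum_first_nat: "2 * (\<Sum>i<r. int i) = int r * (int r - 1)"
  by (induction r) (simp_all add: algebra_simps)

lemma sum_first_squares: "6 * (\<Sum>i<r. (int i)\<^sup>2) = (int r - 1) * int r * (2 * int r - 1)"
  by (induction r) (simp_all add: algebra_simps power2_eq_square)

lemma choose_two_int: "2 * int ((r + 1) choose 2) = (int r + 1) * int r"
  by (induction r) (simp_all add: numeral_2_eq_2 algebra_simps)

lemma choose_three_int: "6 * int ((r + 1) choose 3) = (int r + 1) * int r * (int r - 1)"
proof (induction r)
  case (Suc r)
  have "(Suc r + 1) choose 3 = ((r + 1) choose 2) + ((r + 1) choose 3)"
    by (simp add: numeral_2_eq_2 numeral_3_eq_3)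
  then have "6 * int ((Suc r + 1) choose 3) = 3 * (2 * int ((r + 1) choose 2)) + 6 * int ((r + 1) choose 3)"
    by simp
  then show ?case unfolding Suc choose_two_int by (simp add: algebra_simps)
qed (simp add: numeral_3_eq_3)

text \<open>The three terms on the left-hand side come from the Hankel determinant, from the factor \<open>1 / q\<close> in
  each moment, and from the leading coefficients of the shift polynomials.\<close>

lemma total_exponent:
  assumes "r \<le> n" "r \<le> m"
  shows "int (\<Sum>i<r. i * (n + m - 2 * r + i)) - int r - int (\<Sum>j<r. \<Sum>l<j. (n - l) + (m - l)) =
         - 2 * int ((r + 1) choose 3) - int ((r + 1) choose 2)"
proof -
  define S1 S2 where "S1 = (\<Sum>i<r. int i)" and "S2 = (\<Sum>i<r. (int i)\<^sup>2)"
  have "int (i * (n + m - 2 * r + i)) = int i * (int n + int m - 2 * int r + int i)" for i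
    using assms by (simp add: of_nat_diff)
  then have "int (\<Sum>i<r. i * (n + m - 2 * r + i)) = (\<Sum>i<r. (int n + int m - 2 * int r) * int i + (int i)\<^sup>2)"
    unfolding of_nat_sum
    by (intro sum.cong refl) (simp add: power2_eq_square algebra_simps del: of_nat_mult)
  then have A: "int (\<Sum>i<r. i * (n + m - 2 * r + i)) = (int n + int m - 2 * int r) * S1 + S2"
    by (simp add: S1_def S2_def sum.distrib sum_distrib_left)
  have inner: "int (\<Sum>l<j. (n - l) + (m - l)) = (int n + int m + 1) * int j - (int j)\<^sup>2" if "j \<le> r" for j
    using that
  proof (induction j)
    case (Suc j)
    then have "j < n" "j < m" using assms by auto
    then show ?case using Suc by (simp add: of_nat_diff power2_eq_square algebra_simps)
  qed simp
  have "int (\<Sum>j<r. \<Sum>l<j. (n - l) + (m - l)) = (\<Sum>j<r. (int n + int m + 1) * int j - (int j)\<^sup>2)"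
    unfolding of_nat_sum[of _ "{..<r}"] by (intro sum.cong refl inner) auto
  then have B: "int (\<Sum>j<r. \<Sum>l<j. (n - l) + (m - l)) = (int n + int m + 1) * S1 - S2"
    by (simp add: S1_def S2_def sum_subtractf sum_distrib_left)
  have "2 * S1 = int r * (int r - 1)" "6 * S2 = (int r - 1) * int r * (2 * int r - 1)"
    unfolding S1_def S2_def by (rule sum_first_nat sum_first_squares)+
  moreover from this(1) have "2 * (int r * S1) = int r * (int r * (int r - 1))"
    by (simp only: mult.left_commute[of 2])
  ultimately have six: "6 * (2 * S2 - 2 * (int r * S1) - S1 - int r) =
      - 2 * ((int r + 1) * int r * (int r - 1)) - 3 * ((int r + 1) * int r)"
    by (simp add: algebra_simps)
  have choose: "- 2 * ((int r + 1) * int r * (int r - 1)) - 3 * ((int r + 1) * int r) =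
      6 * (- 2 * int ((r + 1) choose 3) - int ((r + 1) choose 2))"
  proof -
    have "6 * (- 2 * int ((r + 1) choose 3) - int ((r + 1) choose 2)) =
        - 2 * (6 * int ((r + 1) choose 3)) - 3 * (2 * int ((r + 1) choose 2))"
      by simp
    then show ?thesis by (simp only: choose_three_int choose_two_int)
  qed
  have "2 * S2 - 2 * (int r * S1) - S1 - int r = - 2 * int ((r + 1) choose 3) - int ((r + 1) choose 2)"
    using trans[OF six choose] by (subst (asm) mult_left_cancel) simp_all
  moreover have "(int n + int m - 2 * int r) * S1 + S2 - int r - ((int n + int m + 1) * S1 - S2) =
      2 * S2 - 2 * (int r * S1) - S1 - int r"
    by (simp add: algebra_simps)
  ultimately show ?thesis unfolding A B by (simp only:)
qed

text \<open>All arguments of the \<open>q\<close>-gamma function are positive integers here, where it is a finite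
  product.  The last factor on the right-hand side collects all powers of \<open>1 - q\<close>.\<close>

lemma gamma_factor:
  assumes q: "0 < q" "q < 1" and r: "r \<le> n" "r \<le> m" and i: "i < r"
  shows "(qGamma q (2 * real n + 1) / (qGamma q (real n - real (Suc i) + 1))\<^sup>2)
      * (qGamma q (2 * real m + 1) / (qGamma q (real m - real (Suc i) + 1))\<^sup>2)
      * (qGamma q (real (Suc i)) * qGamma q (real (Suc i) + 1)
           * qGamma q (real m + real n - real (Suc i) - real r + 1)
         / qGamma q (real m + real n - real (Suc i) + 2)) =
    qpoch q q (2 * n) * qpoch q q (2 * m) *
    (1 / (qpoch q q (n - i - 1))\<^sup>2) * (1 / (qpoch q q (m - i - 1))\<^sup>2) *
    (qpoch q q i * qpoch q q (Suc i) * (qpoch q q (n + m - i - r - 1) / qpoch q q (n + m - i))) *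
    ((1 - q) ^ (r + 1) / (1 - q) ^ (6 * i + 5))"
proof -
  define d where "d = 1 - q"
  define a b s where "a = n - i - 1" and "b = m - i - 1" and "s = n + m - i - r - 1"
  have d: "d \<noteq> 0" using q by (simp add: d_def)
  have nm: "n = a + i + 1" "m = b + i + 1" "n + m - i = s + r + 1"
    using r i by (auto simp: a_def b_def s_def)
  have G: "qGamma q x = qpoch q q k / d ^ k" if "x = real k + 1" for x k
    using qGamma_nat[OF q] that by (simp add: d_def)
  have s: "real m + real n - real (Suc i) - real r + 1 = real s + 1"
    "real m + real n - real (Suc i) + 2 = real (s + r + 1) + 1"
    using nm(3) r i by (auto simp: s_def of_nat_diff)
  have G1: "qGamma q (2 * real n + 1) = qpoch q q (2 * n) / d ^ (2 * n)"
    "qGamma q (2 * real m + 1) = qpoch q q (2 * m) / d ^ (2 * m)"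
    "qGamma q (real n - real (Suc i) + 1) = qpoch q q a / d ^ a"
    "qGamma q (real m - real (Suc i) + 1) = qpoch q q b / d ^ b"
    "qGamma q (real (Suc i)) = qpoch q q i / d ^ i"
    "qGamma q (real (Suc i) + 1) = qpoch q q (Suc i) / d ^ Suc i"
    by (rule G; simp add: nm)+
  note G2 = G[OF s(1)] G[OF s(2)]
  have pw: "d ^ (2 * n) = (d ^ a * d ^ i * d)\<^sup>2" "d ^ (2 * m) = (d ^ b * d ^ i * d)\<^sup>2"
    unfolding nm by (simp_all only: power_mult[symmetric] power_mult_distrib power_add power_one_right mult.commute[of 2 "_ :: nat"])
       (simp_all add: power_mult power_mult_distrib power2_eq_square power_add mult_ac)
  have pw2: "d ^ (6 * i + 5) = (d ^ i) ^ 6 * d ^ 5" "d ^ (s + r + 1) = d ^ s * d ^ (r + 1)" "d ^ Suc i = d ^ i * d"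
    by (simp_all add: power_add mult.commute flip: power_mult)
  have nz: "d ^ k \<noteq> 0" for k using d by simp
  have "(P / (A * I * d)\<^sup>2 / (pa / A)\<^sup>2) * (Q / (B * I * d)\<^sup>2 / (pb / B)\<^sup>2) *
      (x / I * (y / (I * d)) * (z / S) / (w / (S * R))) =
      P * Q * (1 / pa\<^sup>2) * (1 / pb\<^sup>2) * (x * y * (z / w)) * (R / (I ^ 6 * d ^ 5))"
    if "A \<noteq> 0" "B \<noteq> 0" "I \<noteq> 0" "S \<noteq> 0" for P A I pa Q B pb x y z S w R :: real
    using that d by (simp add: field_simps power2_eq_square numeral_eq_Suc)
  from this[OF nz[of a] nz[of b] nz[of i] nz[of s]] show ?thesis
    unfolding d_def[symmetric] a_def[symmetric] b_def[symmetric] s_def[symmetric]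
    unfolding G1 G2 nm(3) pw pw2 .
qed

lemma sum_node_density_eq_rhs:
  assumes q: "0 < q" "q < 1" and r: "r \<le> n" "r \<le> m"
  shows "(\<Sum>k \<in> {0..<r} \<rightarrow>\<^sub>E {- int n..int n}. node_density q n m r k) / (1 - q) ^ (2 * (r * (r - 1))) =
    fact r * (2 / qbracket q 2) ^ r
      * q powi (- 2 * int ((r + 1) choose 3) - int ((r + 1) choose 2))
      * (\<Prod>i = 1..r.
           (qGamma q (2 * real n + 1) / (qGamma q (real n - real i + 1))\<^sup>2)
         * (qGamma q (2 * real m + 1) / (qGamma q (real m - real i + 1))\<^sup>2)
         * (qGamma q (real i) * qGamma q (real i + 1)
              * qGamma q (real m + real n - real i - real r + 1)
            / qGamma q (real m + real n - real i + 2)))"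
proof -
  define d where "d = 1 - q"
  define E1 E2 where "E1 = (\<Sum>i<r. i * (n + m - 2 * r + i))" and "E2 = (\<Sum>j<r. \<Sum>l<j. (n - l) + (m - l))"
  define S where "S = (\<Sum>k \<in> {0..<r} \<rightarrow>\<^sub>E {- int n..int n}. node_density q n m r k)"
  define U V W where "U = (\<Prod>i<r. 1 / (qpoch q q (n - i - 1))\<^sup>2)" and "V = (\<Prod>i<r. 1 / (qpoch q q (m - i - 1))\<^sup>2)"
    and "W = (\<Prod>i<r. qpoch q q i * qpoch q q (Suc i) * (qpoch q q (n + m - i - r - 1) / qpoch q q (n + m - i)))"
  define T where "T = qpoch q q (2 * n) * qpoch q q (2 * m)"
  have d: "d \<noteq> 0" and q2: "1 - q\<^sup>2 \<noteq> 0"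
    using q by (simp_all add: d_def power2_eq_1_iff)
  have "(\<Prod>i<r. qpoch q q i * qpoch q q (Suc i) / (1 - q) * (qpoch q q (n + m - i - r - 1) / qpoch q q (n + m - i))) = W / d ^ r"
    unfolding W_def by (simp add: prod.distrib prod_dividef d_def)
  then have S: "S * q ^ E2 = fact r * (2 * T / (q * (1 - q\<^sup>2) * d)) ^ r * U * V * (q ^ E1 * (W / d ^ r))"
    using sum_node_density[OF q r] unfolding S_def E1_def E2_def U_def V_def T_def d_def by (simp only: mult.assoc)
  have exp: "q powi (- 2 * int ((r + 1) choose 3) - int ((r + 1) choose 2)) = q ^ E1 / q ^ r / q ^ E2"
    unfolding total_exponent[OF r, symmetric] E1_def[symmetric] E2_def[symmetric]
    using q by (simp add: power_int_diff power_int_of_nat)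
  have br: "2 / qbracket q 2 = 2 * d / (1 - q\<^sup>2)"
    by (simp add: qbracket_def d_def)
  have shift: "(\<Prod>i = 1..r. f i) = (\<Prod>i<r. f (Suc i))" for f :: "nat \<Rightarrow> real"
    by (simp only: One_nat_def prod.atLeast1_atMost_eq)
  have "(\<Prod>i = 1..r.
           (qGamma q (2 * real n + 1) / (qGamma q (real n - real i + 1))\<^sup>2)
         * (qGamma q (2 * real m + 1) / (qGamma q (real m - real i + 1))\<^sup>2)
         * (qGamma q (real i) * qGamma q (real i + 1)
              * qGamma q (real m + real n - real i - real r + 1)
            / qGamma q (real m + real n - real i + 2))) =
     (\<Prod>i<r. T * (1 / (qpoch q q (n - i - 1))\<^sup>2) * (1 / (qpoch q q (m - i - 1))\<^sup>2) *
    (qpoch q q i * qpoch q q (Suc i) * (qpoch q q (n + m - i - r - 1) / qpoch q q (n + m - i))) *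
    (d ^ (r + 1) / d ^ (6 * i + 5)))"
    unfolding shift T_def d_def
    by (intro prod.cong refl gamma_factor[OF q r]) simp
  also have "\<dots> = T ^ r * U * V * W * (d ^ (r * (r + 1)) / d ^ (\<Sum>i<r. 6 * i + 5))"
    unfolding U_def V_def W_def prod.distrib by (simp only: prod_constant card_lessThan prod_dividef power_sum power_mult mult.commute[of r])
  finally have G: "(\<Prod>i = 1..r.
           (qGamma q (2 * real n + 1) / (qGamma q (real n - real i + 1))\<^sup>2)
         * (qGamma q (2 * real m + 1) / (qGamma q (real m - real i + 1))\<^sup>2)
         * (qGamma q (real i) * qGamma q (real i + 1)
              * qGamma q (real m + real n - real i - real r + 1)
            / qGamma q (real m + real n - real i + 2))) =
     T ^ r * U * V * W * (d ^ (r * (r + 1)) / d ^ (\<Sum>i<r. 6 * i + 5))" .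
  have exponents: "(\<Sum>i<r. 6 * i + 5) = 2 * (r * (r - 1)) + r * (r + 1) + r + r + r"
  proof (induction r)
    case (Suc r)
    then show ?case by (cases r) (auto simp: algebra_simps)
  qed simp
  have "a / (b * a * c * c * c) = 1 / (b * c * c * c)" if "a \<noteq> 0" for a b c :: real
    using that by simp
  from this[of "d ^ (r * (r + 1))"] have D: "d ^ (r * (r + 1)) / d ^ (\<Sum>i<r. 6 * i + 5) = 1 / (d ^ (2 * (r * (r - 1))) * d ^ r * d ^ r * d ^ r)"
    unfolding exponents power_add[of d "_ + _"] power_add[of d "2 * _"] using d by simp
  have "S = fact r * (2 * T / (q * (1 - q\<^sup>2) * d)) ^ r * U * V * (q ^ E1 * (W / d ^ r)) / q ^ E2"
  proof -
    have nz: "q ^ E2 \<noteq> 0" using q by simp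
    from S show ?thesis unfolding nonzero_eq_divide_eq[OF nz] .
  qed
  also have "\<dots> / d ^ (2 * (r * (r - 1))) = fact r * (2 * d / (1 - q\<^sup>2)) ^ r * (q ^ E1 / q ^ r / q ^ E2) *
      (T ^ r * U * V * W * (1 / (d ^ (2 * (r * (r - 1))) * d ^ r * d ^ r * d ^ r)))"
  proof -
    have "f * (2 * t / (q * z * d)) ^ r * u * v * (e1 * (w / d ^ r)) / e2 / c =
        f * (2 * d / z) ^ r * (e1 / q ^ r / e2) * (t ^ r * u * v * w * (1 / (c * d ^ r * d ^ r * d ^ r)))"
      if "z \<noteq> 0" for f t z u v w e1 e2 c :: real
      using that d q by (simp add: power_divide power_mult_distrib mult_ac)
    from this[OF q2] show ?thesis .
  qed
  finally show ?thesis
    unfolding S_def[symmetric] d_def[symmetric] exp br G D .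
qed

theorem proposition6p6:
  fixes q :: real and m n r :: nat
  assumes "0 < q" and "q < 1" and "r \<ge> 1"
  shows
    "let
       lhs = (\<Sum>k \<in> {1..r} \<rightarrow>\<^sub>E {- int n..int n}.
                (\<Prod>(i, j) \<in> {(i, j). 1 \<le> i \<and> i < j \<and> j \<le> r}.
                   (qbracket q (k j - k i))\<^sup>2 * (qbracket q (k i + k j))\<^sup>2)
              * (\<Prod>i = 1..r.
                   q powi ((k i)\<^sup>2 - 2 * int i * k i)
                 * \<bar>qbracket (q\<^sup>2) (k i) * (qbracket q (k i))\<^sup>2\<bar>
                 * qbinomial q (2 * int n) (int n + k i)
                 * qbinomial q (2 * int m) (int m + k i)));
       rhs = (\<lambda>(x :: real) (y :: real).
                fact r * (2 / qbracket q 2) ^ r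
              * q powi (- 2 * int ((r + 1) choose 3) - int ((r + 1) choose 2))
              * (\<Prod>i = 1..r.
                   (qGamma q (2 * y + 1) / (qGamma q (y - real i + 1))\<^sup>2)
                 * (qGamma q (2 * x + 1) / (qGamma q (x - real i + 1))\<^sup>2)
                 * (qGamma q (real i) * qGamma q (real i + 1)
                      * qGamma q (x + y - real i - real r + 1)
                    / qGamma q (x + y - real i + 2))));
       numerator_pole =
         (\<exists>i \<in> {1..r}. \<exists>z \<in> {2 * real n + 1, 2 * real m + 1, real i, real i + 1,
                              real m + real n - real i - real r + 1}.
            is_pole (qGamma q) z)
     in
       if numerator_pole
       then ((\<lambda>\<epsilon>. rhs (real m + \<epsilon>) (real n + \<epsilon>)) \<longlongrightarrow> lhs) (at 0)
       else lhs = rhs (real m) (real n)"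
proof -
  define L where "L = (\<Sum>k \<in> {1..r} \<rightarrow>\<^sub>E {- int n..int n}.
                (\<Prod>(i, j) \<in> {(i, j). 1 \<le> i \<and> i < j \<and> j \<le> r}.
                   (qbracket q (k j - k i))\<^sup>2 * (qbracket q (k i + k j))\<^sup>2)
              * (\<Prod>i = 1..r.
                   q powi ((k i)\<^sup>2 - 2 * int i * k i)
                 * \<bar>qbracket (q\<^sup>2) (k i) * (qbracket q (k i))\<^sup>2\<bar>
                 * qbinomial q (2 * int n) (int n + k i)
                 * qbinomial q (2 * int m) (int m + k i)))"
  define G where "G x y = (\<Prod>i = 1..r.
                   (qGamma q (2 * y + 1) / (qGamma q (y - real i + 1))\<^sup>2)
                 * (qGamma q (2 * x + 1) / (qGamma q (x - real i + 1))\<^sup>2)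
                 * (qGamma q (real i) * qGamma q (real i + 1)
                      * qGamma q (x + y - real i - real r + 1)
                    / qGamma q (x + y - real i + 2)))" for x y
  define R where "R x y = fact r * (2 / qbracket q 2) ^ r
              * q powi (- 2 * int ((r + 1) choose 3) - int ((r + 1) choose 2)) * G x y" for x y
  define pole where "pole \<longleftrightarrow> (\<exists>i \<in> {1..r}. \<exists>z \<in> {2 * real n + 1, 2 * real m + 1, real i, real i + 1,
                              real m + real n - real i - real r + 1}. is_pole (qGamma q) z)"
  note q = assms(1,2)
  have L: "L = (\<Sum>k \<in> {0..<r} \<rightarrow>\<^sub>E {- int n..int n}. node_density q n m r k) / (1 - q) ^ (2 * (r * (r - 1)))"
  proof -
    have "(\<Sum>k \<in> {1..r} \<rightarrow>\<^sub>E {- int n..int n}. node_density q n m r (\<lambda>i. k (Suc i))) =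
        (\<Sum>k \<in> {0..<r} \<rightarrow>\<^sub>E {- int n..int n}. node_density q n m r k)"
      by (rule sum_PiE_shift_index) (simp add: node_density_def)
    then show ?thesis
      unfolding L_def summand_eq_node_density[OF q] by (simp flip: sum_divide_distrib)
  qed
  \<comment> \<open>If \<open>r > min m n\<close>, the limit and the plain value both equal \<open>L = 0\<close>; otherwise there is no pole.\<close>
  have "if pole then ((\<lambda>\<epsilon>. R (real m + \<epsilon>) (real n + \<epsilon>)) \<longlongrightarrow> L) (at 0) else L = R (real m) (real n)"
  proof (cases "n < r \<or> m < r")
    case True
    have L0: "L = 0"
      unfolding L by (simp add: node_density_eq_0[OF True])
    have "((\<lambda>\<epsilon>. R (real m + \<epsilon>) (real n + \<epsilon>)) \<longlongrightarrow> L) (at 0)"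
      unfolding R_def L0 G_def
      by (intro tendsto_mult_right_zero gamma_product_tendsto_0 q True)
    moreover have "G (real m) (real n) = 0"
    proof -
      have "qGamma q (real k - real r + 1) = 0" if "k < r" for k
        using qGamma_nonpos_int[OF q, of "r - k - 1"] that by (simp add: of_nat_diff algebra_simps)
      with True have "qGamma q (real n - real r + 1) = 0 \<or> qGamma q (real m - real r + 1) = 0"
        by blast
      then show ?thesis
        unfolding G_def using assms(3) by (intro prod_zero bexI[of _ r]) auto
    qed
    ultimately show ?thesis
      by (simp add: L0 R_def)
  next
    case False
    then have r: "r \<le> n" "r \<le> m" by auto
    have "\<not> is_pole (qGamma q) z"
      if i: "i \<in> {1..r}" and z: "z \<in> {2 * real n + 1, 2 * real m + 1, real i, real i + 1,
           real m + real n - real i - real r + 1}" for i z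
    proof -
      have "z \<in> of_int ` {2 * int n + 1, 2 * int m + 1, int i, int i + 1, int m + int n - int i - int r + 1}"
        using z by simp
      then obtain z' where "z = of_int z'"
        and "z' \<in> {2 * int n + 1, 2 * int m + 1, int i, int i + 1, int m + int n - int i - int r + 1}"
        by blast
      moreover from this(2) have "z' \<ge> 1"
        using i r by auto
      ultimately show ?thesis
        using not_is_pole_qGamma[OF q] by simp
    qed
    then have "\<not> pole" unfolding pole_def by blast
    moreover have "L = R (real m) (real n)"
      unfolding L R_def G_def by (rule sum_node_density_eq_rhs[OF q r])
    ultimately show ?thesis by simp
  qed
  then show ?thesis
    unfolding L_def R_def G_def pole_def Let_def .
qed

end
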